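(* Let $J\subseteq R=\mathbb{K}[x_1,\ldots,x_n]$ be a $C$-matroidal ideal and let $\mathbb{F}_\bullet$ be any minimal multigraded free resolution of $R/J$. Then for every $h\geq 1$, $$G(SF_h(J))=\mathrm{mdeg}(\mathbb{F}_h).$$
   Context: $\mathbb{K}$ is a field. A squarefree monomial ideal $J\subseteq R$ is $C$-matroidal if it is the cover ideal $J(\mathcal{M})=\bigcap_{F\in\mathcal{B}(\mathcal{M})}(x_i:i\in F)$ of some matroid $\mathcal{M}$ on $[n]$ (equivalently, the Stanley–Reisner ideal of the independence complex of a matroid), where $\mathcal{B}(\mathcal{M})$ is the set of bases. For a squarefree monomial ideal $I$ with minimal primes $\mathfrak q_1,\ldots,\mathfrak q_t$, $I^{(h)}=\bigcap_j\mathfrak q_j^h$, and $SF_h(I)$ is the ideal generated by all squarefree monomials in $I^{(h)}$. $G(I)$ is the set of minimal monomial generators of a monomial ideal $I$. For a multigraded free module $F$, $\mathrm{mdeg}(F)$ is the set of monomials that are the multidegrees of a homogeneous basis of $F$. *)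

theory Defs
  imports "HOL-Library.Poly_Mapping"
begin

type_synonym monom = "nat \<Rightarrow>\<^sub>0 nat"
type_synonym 'k mpoly = "monom \<Rightarrow>\<^sub>0 'k"

definition polyring :: "nat \<Rightarrow> ('k::field) mpoly set" where
  "polyring n = {p :: 'k mpoly. \<forall>m \<in> Poly_Mapping.keys p. Poly_Mapping.keys m \<subseteq> {1..n}}"

definition monomial :: "monom \<Rightarrow> ('k::field) mpoly" where
  "monomial a = Poly_Mapping.single a 1"

definition var :: "nat \<Rightarrow> ('k::field) mpoly" where
  "var i = monomial (Poly_Mapping.single i 1)"

definition is_ideal :: "nat \<Rightarrow> ('k::field) mpoly set \<Rightarrow> bool" where
  "is_ideal n I \<longleftrightarrow> I \<subseteq> polyring n \<and> 0 \<in> I \<and>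
     (\<forall>a\<in>I. \<forall>b\<in>I. a + b \<in> I) \<and> (\<forall>r\<in>polyring n. \<forall>a\<in>I. r * a \<in> I)"

definition ideal_gen :: "nat \<Rightarrow> ('k::field) mpoly set \<Rightarrow> 'k mpoly set" where
  "ideal_gen n S = \<Inter> {I. is_ideal n I \<and> S \<subseteq> I}"

definition ideal_pow :: "nat \<Rightarrow> ('k::field) mpoly set \<Rightarrow> nat \<Rightarrow> 'k mpoly set" where
  "ideal_pow n I h = ideal_gen n {prod_list xs | xs. length xs = h \<and> set xs \<subseteq> I}"

definition is_prime_ideal :: "nat \<Rightarrow> ('k::field) mpoly set \<Rightarrow> bool" where
  "is_prime_ideal n P \<longleftrightarrow> is_ideal n P \<and> P \<noteq> polyring n \<and>
     (\<forall>a\<in>polyring n. \<forall>b\<in>polyring n. a * b \<in> P \<longrightarrow> a \<in> P \<or> b \<in> P)"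

definition minimal_primes :: "nat \<Rightarrow> ('k::field) mpoly set \<Rightarrow> 'k mpoly set set" where
  "minimal_primes n I = {P. is_prime_ideal n P \<and> I \<subseteq> P \<and>
     (\<forall>Q. is_prime_ideal n Q \<and> I \<subseteq> Q \<and> Q \<subseteq> P \<longrightarrow> Q = P)}"

definition symb_pow :: "nat \<Rightarrow> ('k::field) mpoly set \<Rightarrow> nat \<Rightarrow> 'k mpoly set" where
  "symb_pow n I h = polyring n \<inter> (\<Inter> P \<in> minimal_primes n I. ideal_pow n P h)"

definition squarefree_monom :: "monom \<Rightarrow> bool" where
  "squarefree_monom a \<longleftrightarrow> (\<forall>i. Poly_Mapping.lookup a i \<le> 1)"

definition SF :: "nat \<Rightarrow> nat \<Rightarrow> ('k::field) mpoly set \<Rightarrow> 'k mpoly set" where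
  "SF n h I = ideal_gen n {monomial a | a. squarefree_monom a \<and> monomial a \<in> symb_pow n I h}"

definition monom_dvd :: "monom \<Rightarrow> monom \<Rightarrow> bool" where
  "monom_dvd b a \<longleftrightarrow> (\<forall>i. Poly_Mapping.lookup b i \<le> Poly_Mapping.lookup a i)"

definition mingens :: "nat \<Rightarrow> ('k::field) mpoly set \<Rightarrow> monom set" where
  "mingens n I = {a. (monomial a :: 'k mpoly) \<in> I \<and>
     (\<forall>b. (monomial b :: 'k mpoly) \<in> I \<and> monom_dvd b a \<longrightarrow> b = a)}"

definition matroid_bases :: "nat \<Rightarrow> nat set set \<Rightarrow> bool" where
  "matroid_bases n \<B> \<longleftrightarrow> \<B> \<noteq> {} \<and> (\<forall>B\<in>\<B>. B \<subseteq> {1..n}) \<and>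
     (\<forall>B1\<in>\<B>. \<forall>B2\<in>\<B>. \<forall>x\<in>B1 - B2. \<exists>y\<in>B2 - B1. insert y (B1 - {x}) \<in> \<B>)"

definition prime_of :: "nat \<Rightarrow> nat set \<Rightarrow> ('k::field) mpoly set" where
  "prime_of n F = ideal_gen n (var ` F)"

definition cover_ideal :: "nat \<Rightarrow> nat set set \<Rightarrow> ('k::field) mpoly set" where
  "cover_ideal n \<B> = polyring n \<inter> (\<Inter> F \<in> \<B>. prime_of n F)"

definition C_matroidal :: "nat \<Rightarrow> ('k::field) mpoly set \<Rightarrow> bool" where
  "C_matroidal n J \<longleftrightarrow> (\<exists>\<B>. matroid_bases n \<B> \<and> J = cover_ideal n \<B>)"

text \<open>A multigraded free resolution of R/J is encoded by
  r h        : rank of F_h (basis e_0,...,e_{r h - 1}),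
  dg h j     : multidegree of the basis element e_j of F_h,
  D h i j    : (h \<ge> 1) the coefficient of e_i in d_h(e_j), i.e. the matrix of d_h : F_h \<rightarrow> F_{h-1},
  E i        : the image of e_i under the augmentation F_0 \<rightarrow> R/J (a representative in R).
Elements of F_h are coefficient vectors in R indexed by {0..<r h}.\<close>

definition freemod :: "nat \<Rightarrow> nat \<Rightarrow> (nat \<Rightarrow> ('k::field) mpoly) set" where
  "freemod n r = {v. (\<forall>j<r. v j \<in> polyring n) \<and> (\<forall>j\<ge>r. v j = 0)}"

definition apply_mat :: "nat \<Rightarrow> nat \<Rightarrow> (nat \<Rightarrow> nat \<Rightarrow> ('k::field) mpoly)
    \<Rightarrow> (nat \<Rightarrow> 'k mpoly) \<Rightarrow> (nat \<Rightarrow> 'k mpoly)" where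
  "apply_mat rt rs M v = (\<lambda>i. if i < rt then (\<Sum>j<rs. M i j * v j) else 0)"

definition homog :: "('k::field) mpoly \<Rightarrow> monom \<Rightarrow> bool" where
  "homog p a \<longleftrightarrow> Poly_Mapping.keys p \<subseteq> {a}"

definition min_mg_free_res ::
  "nat \<Rightarrow> ('k::field) mpoly set \<Rightarrow> (nat \<Rightarrow> nat) \<Rightarrow> (nat \<Rightarrow> nat \<Rightarrow> monom)
     \<Rightarrow> (nat \<Rightarrow> nat \<Rightarrow> nat \<Rightarrow> 'k mpoly) \<Rightarrow> (nat \<Rightarrow> 'k mpoly) \<Rightarrow> bool" where
  "min_mg_free_res n J r dg D E \<longleftrightarrow>
     \<comment> \<open>basis degrees are monomials of R\<close>
     (\<forall>h j. j < r h \<longrightarrow> Poly_Mapping.keys (dg h j) \<subseteq> {1..n}) \<and>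
     \<comment> \<open>the differentials are multigraded maps with entries in R\<close>
     (\<forall>h\<ge>1. \<forall>i<r (h-1). \<forall>j<r h. D h i j \<in> polyring n \<and>
        (\<forall>m\<in>Poly_Mapping.keys (D h i j). m + dg (h-1) i = dg h j)) \<and>
     \<comment> \<open>the augmentation is a multigraded map F_0 \<rightarrow> R/J\<close>
     (\<forall>i<r 0. E i \<in> polyring n \<and> homog (E i) (dg 0 i)) \<and>
     \<comment> \<open>exactness: F_0 \<rightarrow> R/J \<rightarrow> 0\<close>
     (\<forall>f\<in>polyring n. \<exists>v\<in>freemod n (r 0). f - (\<Sum>i<r 0. v i * E i) \<in> J) \<and>
     \<comment> \<open>exactness at F_0\<close>
     (\<forall>v\<in>freemod n (r 0). (\<Sum>i<r 0. v i * E i) \<in> J \<longleftrightarrow>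
        (\<exists>w\<in>freemod n (r 1). v = apply_mat (r 0) (r 1) (D 1) w)) \<and>
     \<comment> \<open>exactness at F_h, h \<ge> 1\<close>
     (\<forall>h\<ge>1. \<forall>v\<in>freemod n (r h). apply_mat (r (h-1)) (r h) (D h) v = (\<lambda>_. 0) \<longleftrightarrow>
        (\<exists>w\<in>freemod n (r (h+1)). v = apply_mat (r h) (r (h+1)) (D (h+1)) w)) \<and>
     \<comment> \<open>minimality: d_h(F_h) \<subseteq> m F_{h-1}, m = (x_1,...,x_n)\<close>
     (\<forall>h\<ge>1. \<forall>i<r (h-1). \<forall>j<r h. D h i j \<in> ideal_gen n (var ` {1..n}))"

definition mdeg :: "(nat \<Rightarrow> nat) \<Rightarrow> (nat \<Rightarrow> nat \<Rightarrow> monom) \<Rightarrow> nat \<Rightarrow> monom set" where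
  "mdeg r dg h = dg h ` {0..<r h}"

end

theory Submission
  imports Defs
begin

text \<open>
  Setting all variables to \<open>1\<close> turns the degree-\<open>b\<close> strand of the resolution into the span of
  the basis vectors of degree at most \<open>b\<close>, with a fixed scalar differential \<open>d\<close>, exact for each \<open>b\<close>
  except that in homological degree \<open>0\<close> the cokernel is nonzero when the monomial \<open>b\<close> is not in
  \<open>J\<close>. Minimality says that \<open>d\<close> strictly lowers degrees. If \<open>J\<close> does not distinguish \<open>b\<close> from a smaller
  \<open>\<phi> b\<close>, then only fixed points of \<open>\<phi>\<close> occur as degrees; so all degrees are squarefree, and
  all are coloop-free in the dual matroid. Let \<open>\<nu> S\<close> be the nullity of \<open>S\<close> in the dual matroid, so
  that \<open>\<nu> S > 0\<close> iff the squarefree monomial of \<open>S\<close> is in \<open>J\<close>. A Mayer--Vietoris induction over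
  the subcomplexes spanned by the degrees inside some \<open>S - {i}\<close>, \<open>i \<in> A\<close>, shows that \<open>S\<close> cannot
  be a degree of \<open>F\<^sub>h\<close> if \<open>\<nu> S > h\<close>; a minimal boundary involves a proper subset of nullity
  \<open>h - 1\<close>, so \<open>\<nu> S \<ge> h\<close> as \<open>S\<close> has no coloop. Conversely, for \<open>A = S \<inter> B\<close> with a basis \<open>B\<close>
  attaining \<open>card A = \<nu> S = h\<close>, the same sequences give a nonzero class in homological degree
  \<open>h - 1\<close>, which only a basis element of degree \<open>S\<close> in \<open>F\<^sub>h\<close> can kill. The coloop-free \<open>S\<close> with
  \<open>\<nu> S = h\<close> are the minimal \<open>S\<close> with \<open>\<nu> S \<ge> h\<close>, i.e. the generators of \<open>SF\<^sub>h(J)\<close>.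
\<close>

subsection \<open>Minimal resolutions as filtered complexes\<close>

text \<open>In the locale below, \<open>sp p X\<close> is the span of the basis vectors of \<open>F\<^sub>p\<close> with degree in \<open>X\<close>, and
  \<open>d p\<close> is the dehomogenised differential from \<open>F\<^sub>p\<^sub>+\<^sub>1\<close> to \<open>F\<^sub>p\<close> (not from \<open>F\<^sub>p\<close>).\<close>

locale filtered_resolution =
  fixes r :: "nat \<Rightarrow> nat" and dg :: "nat \<Rightarrow> nat \<Rightarrow> 'd::order_bot"
    and \<delta> :: "nat \<Rightarrow> nat \<Rightarrow> nat \<Rightarrow> 'k::field" and \<epsilon> :: "nat \<Rightarrow> 'k"
    and \<Omega> :: "'d set" and \<J> :: "'d set"
    and sp :: "nat \<Rightarrow> 'd set \<Rightarrow> (nat \<Rightarrow> 'k) set"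
    and d :: "nat \<Rightarrow> (nat \<Rightarrow> 'k) \<Rightarrow> (nat \<Rightarrow> 'k)"
  defines "sp \<equiv> \<lambda>p X. {c. \<forall>j. c j \<noteq> 0 \<longrightarrow> j < r p \<and> dg p j \<in> X}"
    and "d \<equiv> \<lambda>p c i. if i < r p then \<Sum>j<r (Suc p). \<delta> p i j * c j else 0"
  assumes dg_in: "j < r p \<Longrightarrow> dg p j \<in> \<Omega>"
    and strict: "i < r p \<Longrightarrow> j < r (Suc p) \<Longrightarrow> \<delta> p i j \<noteq> 0 \<Longrightarrow> dg p i < dg (Suc p) j"
    and exact: "b \<in> \<Omega> \<Longrightarrow> z \<in> sp (Suc p) {..b} \<Longrightarrow>
      d p z = (\<lambda>_. 0) \<longleftrightarrow> (\<exists>u\<in>sp (Suc (Suc p)) {..b}. d (Suc p) u = z)"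
    and exact0: "b \<in> \<Omega> \<Longrightarrow> z \<in> sp 0 {..b} \<Longrightarrow>
      (\<exists>u\<in>sp 1 {..b}. d 0 u = z) \<longleftrightarrow> b \<in> \<J> \<or> (\<Sum>i<r 0. \<epsilon> i * z i) = 0"
    and aug: "\<exists>i<r 0. dg 0 i = bot \<and> \<epsilon> i \<noteq> 0"
begin

text \<open>Every chain in homological degree 0 counts as a cycle, so that inductions on the
  homological degree can start there with the same wording.\<close>

definition cyc :: "nat \<Rightarrow> (nat \<Rightarrow> 'k) \<Rightarrow> bool" where
  "cyc p z = (case p of 0 \<Rightarrow> True | Suc q \<Rightarrow> d q z = (\<lambda>_. 0))"

lemma cyc_simps [simp]: "cyc 0 z" "cyc (Suc q) z \<longleftrightarrow> d q z = (\<lambda>_. 0)"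
  by (simp_all add: cyc_def)

lemma sp_I: "(\<And>j. c j \<noteq> 0 \<Longrightarrow> j < r p \<and> dg p j \<in> X) \<Longrightarrow> c \<in> sp p X"
  by (simp add: sp_def)

lemma sp_D: "c \<in> sp p X \<Longrightarrow> c j \<noteq> 0 \<Longrightarrow> j < r p \<and> dg p j \<in> X"
  by (simp add: sp_def)

lemma sp_mono: "X \<subseteq> Y \<Longrightarrow> sp p X \<subseteq> sp p Y"
  by (auto simp: sp_def)

lemma sp_Int: "sp p (X \<inter> Y) = sp p X \<inter> sp p Y"
  by (auto simp: sp_def)

lemma sp_add: "x \<in> sp p X \<Longrightarrow> y \<in> sp p X \<Longrightarrow> (\<lambda>i. x i + y i) \<in> sp p X"
  by (auto simp: sp_def) (metis add_0)+

lemma sp_diff: "x \<in> sp p X \<Longrightarrow> y \<in> sp p X \<Longrightarrow> (\<lambda>i. x i - y i) \<in> sp p X"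
  by (auto simp: sp_def) (metis diff_0_right)+

lemma sp_uminus: "y \<in> sp p X \<Longrightarrow> (\<lambda>i. 0 - y i) \<in> sp p X"
  by (auto simp: sp_def)

lemma sp_Un:
  assumes "z \<in> sp p (X \<union> Y)"
  obtains x y where "x \<in> sp p X" "y \<in> sp p Y" "z = (\<lambda>i. x i + y i)"
proof
  show "(\<lambda>i. if dg p i \<in> X then z i else 0) \<in> sp p X"
    "(\<lambda>i. if dg p i \<in> X then 0 else z i) \<in> sp p Y"
    using assms by (auto simp: sp_def split: if_splits)
qed auto

lemma d_add: "d p (\<lambda>i. x i + y i) = (\<lambda>i. d p x i + d p y i)"
  by (auto simp: d_def fun_eq_iff algebra_simps sum.distrib)

lemma d_diff: "d p (\<lambda>i. x i - y i) = (\<lambda>i. d p x i - d p y i)"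
  by (auto simp: d_def fun_eq_iff algebra_simps sum_subtractf)

lemma d_support:
  assumes "d p u i \<noteq> 0"
  obtains j where "i < r p" "j < r (Suc p)" "u j \<noteq> 0" "dg p i < dg (Suc p) j"
proof -
  have i: "i < r p" and s: "(\<Sum>j<r (Suc p). \<delta> p i j * u j) \<noteq> 0"
    using assms by (auto simp: d_def split: if_splits)
  then obtain j where "j < r (Suc p)" "\<delta> p i j * u j \<noteq> 0"
    by (meson lessThan_iff sum.neutral)
  then show ?thesis using i strict that by auto
qed

lemma d_sp:
  assumes "u \<in> sp (Suc p) X" and "\<And>a b. b \<in> X \<Longrightarrow> a \<le> b \<Longrightarrow> a \<in> X"
  shows "d p u \<in> sp p X"
proof (rule sp_I)
  fix i assume "d p u i \<noteq> 0"
  then obtain j where "i < r p" "u j \<noteq> 0" "dg p i < dg (Suc p) j" by (rule d_support)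
  then show "i < r p \<and> dg p i \<in> X" using assms sp_D[OF assms(1)] by (meson less_imp_le)
qed

lemma cyc_d: "b \<in> \<Omega> \<Longrightarrow> u \<in> sp (Suc p) {..b} \<Longrightarrow> cyc p (d p u)"
proof (cases p)
  case (Suc q)
  assume b: "b \<in> \<Omega>" and u: "u \<in> sp (Suc p) {..b}"
  have "d p u \<in> sp p {..b}" using u by (rule d_sp) auto
  then show ?thesis using exact[OF b, of "d p u" q] u Suc by auto
qed simp

lemma cyc_exact:
  "b \<in> \<Omega> \<Longrightarrow> z \<in> sp p {..b} \<Longrightarrow> cyc p z \<Longrightarrow> b \<in> \<J> \<or> p \<noteq> 0 \<Longrightarrow>
    \<exists>u\<in>sp (Suc p) {..b}. d p u = z"
  using exact exact0 by (cases p) auto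

abbreviation unit :: "nat \<Rightarrow> nat \<Rightarrow> 'k" where
  "unit j \<equiv> \<lambda>i. if i = j then 1 else 0"

lemma unit_sp: "j < r p \<Longrightarrow> dg p j \<in> X \<Longrightarrow> unit j \<in> sp p X"
  by (auto simp: sp_def)

text \<open>By minimality, a basis element of degree \<open>b\<close> cannot be replaced by elements of smaller
  degree without changing its boundary.\<close>

lemma coeff_of_unit_boundary:
  assumes j: "j < r (Suc p)" and u: "u \<in> sp (Suc p) {..dg (Suc p) j}" and eq: "d p u = d p (unit j)"
  shows "u j = 1"
proof -
  define v where "v = (\<lambda>i. unit j i - u i)"
  have v: "v \<in> sp (Suc p) {..dg (Suc p) j}"
    unfolding v_def by (rule sp_diff[OF unit_sp[OF j] u]) simp
  have "d p v = (\<lambda>_. 0)" unfolding v_def d_diff eq by simp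
  then obtain w where w: "w \<in> sp (Suc (Suc p)) {..dg (Suc p) j}" "d (Suc p) w = v"
    using exact[OF dg_in[OF j] v] by auto
  \<comment> \<open>\<open>w\<close> only involves degrees at most \<open>dg (Suc p) j\<close>,
    whereas a nonzero entry of its boundary at \<open>j\<close> requires a strictly larger
    one.\<close>
  have "v j = 0"
  proof (rule ccontr)
    assume "v j \<noteq> 0"
    then obtain l where "w l \<noteq> 0" "dg (Suc p) j < dg (Suc (Suc p)) l"
      using w(2) d_support by metis
    then show False using sp_D[OF w(1)] by (metis atMost_iff leD)
  qed
  then show ?thesis by (simp add: v_def)
qed

lemma d_zero: "d p (\<lambda>_. 0) = (\<lambda>_. 0)"
  by (simp add: d_def fun_eq_iff)

text \<open>The zero chain cannot share the boundary of \<open>unit j\<close>, because its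
  coefficient at \<open>j\<close> is not 1.\<close>

lemma unit_boundary_nonzero: "j < r (Suc p) \<Longrightarrow> d p (unit j) \<noteq> (\<lambda>_. 0)"
  using coeff_of_unit_boundary[of j p "\<lambda>_. 0"] sp_I[of "\<lambda>_. 0"] d_zero by fastforce

lemma sum_unit: "j < r 0 \<Longrightarrow> (\<Sum>i<r 0. f i * unit j i) = f j"
  using sum.delta[of "{..<r 0}" j f] by (simp add: if_distrib cong: if_cong)

text \<open>Otherwise subtract from \<open>unit j\<close> the multiple of a generator of degree
  \<open>bot\<close> that makes the augmentation vanish. The result bounds below
  \<open>dg 0 j\<close>, where boundaries have no entry at \<open>j\<close>; but its entry at
  \<open>j\<close> is 1.\<close>

lemma dg_0:
  assumes j: "j < r 0"
  shows "dg 0 j = bot"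
proof (rule ccontr)
  assume ne: "dg 0 j \<noteq> bot"
  obtain i where i: "i < r 0" "dg 0 i = bot" "\<epsilon> i \<noteq> 0" using aug by auto
  define v where "v = (\<lambda>l. unit j l - \<epsilon> j / \<epsilon> i * unit i l)"
  have v: "v \<in> sp 0 {..dg 0 j}" using i j by (auto simp: v_def sp_def split: if_splits)
  have "(\<Sum>l<r 0. \<epsilon> l * v l) =
      (\<Sum>l<r 0. \<epsilon> l * unit j l) - \<epsilon> j / \<epsilon> i * (\<Sum>l<r 0. \<epsilon> l * unit i l)"
    unfolding v_def sum_distrib_left sum_subtractf[symmetric]
    by (rule sum.cong) (auto simp: algebra_simps)
  also have "\<dots> = 0" using i j by (simp only: sum_unit) simp
  finally obtain w where w: "w \<in> sp 1 {..dg 0 j}" "d 0 w = v"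
    using exact0[OF dg_in[OF j] v] by auto
  have "v j = 1" using i ne by (auto simp: v_def)
  then obtain l where "w l \<noteq> 0" "dg 0 j < dg 1 l"
    using w(2) d_support[of 0 w j] by auto
  then show False using sp_D[OF w(1)] by (metis atMost_iff leD)
qed

text \<open>If the ideal does not see the difference between \<open>b\<close> and \<open>\<phi> b\<close>, neither does the
  resolution.\<close>

lemma degrees_fixed:
  assumes U: "U \<subseteq> \<Omega>" "\<And>b c. b \<in> U \<Longrightarrow> c \<in> \<Omega> \<Longrightarrow> c \<le> b \<Longrightarrow> c \<in> U"
    and \<phi>: "\<And>b. b \<in> U \<Longrightarrow> \<phi> b \<in> \<Omega>" "\<And>b. b \<in> U \<Longrightarrow> \<phi> b \<le> b"
      "\<And>b c. b \<in> U \<Longrightarrow> c \<in> U \<Longrightarrow> c \<le> b \<Longrightarrow> \<phi> c \<le> \<phi> b"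
      "\<And>b. b \<in> U \<Longrightarrow> b \<in> \<J> \<Longrightarrow> \<phi> b \<in> \<J>"
  shows "j < r p \<Longrightarrow> dg p j \<in> U \<Longrightarrow> \<phi> (dg p j) = dg p j"
proof (induction p arbitrary: j)
  case 0
  then show ?case using dg_0 \<phi>(2) by (metis bot.extremum_unique)
next
  case (Suc p)
  define b where "b = dg (Suc p) j"
  have bU: "b \<in> U" and b\<Omega>: "b \<in> \<Omega>" using Suc.prems U by (auto simp: b_def)
  have e: "unit j \<in> sp (Suc p) {..b}" using Suc.prems by (simp add: b_def unit_sp)
  have de: "d p (unit j) \<in> sp p {..b}" using e by (rule d_sp) auto
  \<comment> \<open>The degrees occurring in this boundary lie in \<open>U\<close>, so by induction
    \<phi> fixes them, and monotonicity puts them below \<open>\<phi> b\<close>.\<close>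
  have de': "d p (unit j) \<in> sp p {..\<phi> b}"
  proof (rule sp_I)
    fix i assume "d p (unit j) i \<noteq> 0"
    from sp_D[OF de this] have i: "i < r p" "dg p i \<le> b" by auto
    then have iU: "dg p i \<in> U" using U bU dg_in by blast
    have "dg p i = \<phi> (dg p i)" using Suc.IH i iU by simp
    also have "\<dots> \<le> \<phi> b" using \<phi>(3) bU iU i by blast
    finally show "i < r p \<and> dg p i \<in> {..\<phi> b}" using i by simp
  qed
  \<comment> \<open>Exactness at \<open>\<phi> b\<close> fills the boundary there. For
    \<open>p = 0\<close> this is where \<phi> preserving \<open>\<J>\<close> enters.\<close>
  obtain u where u: "u \<in> sp (Suc p) {..\<phi> b}" "d p u = d p (unit j)"
  proof (cases p)
    case 0
    have "b \<in> \<J> \<or> (\<Sum>i<r 0. \<epsilon> i * d 0 (unit j) i) = 0"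
      using exact0[OF b\<Omega>, of "d 0 (unit j)"] de e 0 by auto
    then show ?thesis using exact0[OF \<phi>(1)[OF bU], of "d 0 (unit j)"] de' 0 \<phi>(4)[OF bU] that by auto
  next
    case (Suc q)
    then show ?thesis using cyc_exact[OF \<phi>(1)[OF bU] de'] cyc_d[OF b\<Omega> e] that by auto
  qed
  have "u \<in> sp (Suc p) {..b}" using u(1) sp_mono[of "{..\<phi> b}" "{..b}"] \<phi>(2)[OF bU] by auto
  then have "u j = 1" using coeff_of_unit_boundary Suc.prems u(2) b_def by blast
  then have "b \<le> \<phi> b" using sp_D[OF u(1), of j] by (simp add: b_def)
  then show ?case using \<phi>(2)[OF bU] b_def by auto
qed

end

subsection \<open>Degrees in a matroid\<close>

text \<open>With \<open>\<nu> S = Min {card (S \<inter> B) | B. B \<in> \<B>}\<close>, the nullity of \<open>S\<close> in the dual matroid,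
  \<open>hits \<B> h S\<close> says \<open>h \<le> \<nu> S\<close>.\<close>

definition hits :: "nat set set \<Rightarrow> nat \<Rightarrow> nat set \<Rightarrow> bool" where
  "hits \<B> h S \<longleftrightarrow> (\<forall>B\<in>\<B>. h \<le> card (S \<inter> B))"

lemma hits_antimono: "hits \<B> k S \<Longrightarrow> h \<le> k \<Longrightarrow> hits \<B> h S"
  unfolding hits_def by (meson le_trans)

lemma hits_mono: "hits \<B> h T \<Longrightarrow> T \<subseteq> S \<Longrightarrow> finite S \<Longrightarrow> hits \<B> h S"
  unfolding hits_def by (meson Int_mono card_mono finite_Int le_trans order_refl)

lemma hits_remove: "hits \<B> (Suc h) S \<Longrightarrow> hits \<B> h (S - {i})"
  unfolding hits_def
proof
  fix B assume *: "\<forall>B\<in>\<B>. Suc h \<le> card (S \<inter> B)" "B \<in> \<B>"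
  have "(S - {i}) \<inter> B = (S \<inter> B) - {i}" by auto
  then show "h \<le> card ((S - {i}) \<inter> B)" using * card_Diff_singleton_if[of "S \<inter> B" i]
    by (metis Suc_le_mono Suc_pred diff_Suc_1 diff_le_mono le_SucI le_diff_conv le_trans nat_le_linear)
qed

lemma hits_1: "finite S \<Longrightarrow> hits \<B> (Suc 0) S \<longleftrightarrow> (\<forall>B\<in>\<B>. S \<inter> B \<noteq> {})"
  unfolding hits_def by (simp add: Suc_le_eq card_gt_0_iff)

text \<open>The number \<open>k\<close> is the nullity \<open>\<nu> S\<close>; any single basis
  bounds it.\<close>

lemma maximal_hits:
  assumes "\<B> \<noteq> {}"
  obtains k where "hits \<B> k S" "\<not> hits \<B> (Suc k) S"
proof -
  obtain B where "B \<in> \<B>" using assms by auto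
  then have "\<not> hits \<B> (Suc (card (S \<inter> B))) S" by (auto simp: hits_def not_le)
  moreover have "hits \<B> 0 S" by (simp add: hits_def)
  ultimately have "\<exists>k. hits \<B> k S \<and> \<not> hits \<B> (Suc k) S"
    using nat_induct[of "\<lambda>k. hits \<B> k S"] by blast
  then show ?thesis using that by blast
qed

text \<open>For a matroid on \<open>E\<close> and \<open>h = 1\<close> these are the circuits of the
  dual matroid.\<close>

definition minhits :: "nat set \<Rightarrow> nat set set \<Rightarrow> nat \<Rightarrow> nat set set" where
  "minhits E \<B> h = {S. S \<subseteq> E \<and> hits \<B> h S \<and> (\<forall>T. T \<subseteq> S \<longrightarrow> hits \<B> h T \<longrightarrow> T = S)}"

section \<open>Mayer--Vietoris sequences for deletions of elements\<close>

locale set_resolution = filtered_resolution r dg \<delta> \<epsilon> "Pow E" "{S. hits \<B> (Suc 0) S}" sp d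
  for r and dg :: "nat \<Rightarrow> nat \<Rightarrow> nat set" and \<delta> :: "nat \<Rightarrow> nat \<Rightarrow> nat \<Rightarrow> 'k::field" and \<epsilon> E \<B> sp d +
  assumes finite_E: "finite E" and bases: "\<B> \<noteq> {}"
begin

text \<open>A union of principal down-sets, to which deletions can be added one at a time. For
  \<open>A = S\<close> it consists of all proper subsets of \<open>S\<close>.\<close>

definition del :: "nat set \<Rightarrow> nat set \<Rightarrow> nat set set" where
  "del S A = (\<Union>i\<in>A. {..S - {i}})"

text \<open>Positive nullity puts \<open>S\<close> into the ideal, which makes the strand exact in
  homological degree 0 as well.\<close>

lemma dependent_exact:
  assumes "S \<subseteq> E" "hits \<B> (Suc h) S" "z \<in> sp p {..S}" "cyc p z"
  obtains u where "u \<in> sp (Suc p) {..S}" "d p u = z"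
proof -
  have "hits \<B> (Suc 0) S" using assms(2) by (rule hits_antimono) simp
  then show ?thesis using cyc_exact[of S z p] assms that by auto
qed

lemma del_insert: "del S (insert j A) = del S A \<union> {..S - {j}}"
  by (auto simp: del_def)

text \<open>The intersection term of the Mayer--Vietoris sequence is again of the form
  \<open>del\<close>, for a set with one element fewer; this drives both inductions below.\<close>

lemma del_Int: "del S A \<inter> {..S - {j}} = del (S - {j}) A"
  by (auto simp: del_def)

lemma sp_del_Int: "x \<in> sp p (del (S - {j}) A) \<longleftrightarrow> x \<in> sp p (del S A) \<and> x \<in> sp p {..S - {j}}"
  using sp_Int[of p "del S A" "{..S - {j}}"] unfolding del_Int by blast

lemma del_subset: "del S A \<subseteq> {..S}"
  by (auto simp: del_def)

lemma del_down: "b \<in> del S A \<Longrightarrow> a \<le> b \<Longrightarrow> a \<in> del S A"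
  by (auto simp: del_def)

text \<open>Mayer--Vietoris, adding one deletion at a time.\<close>

lemma del_exact:
  assumes "finite A" "A \<noteq> {}"
  shows "S \<subseteq> E \<Longrightarrow> hits \<B> (Suc (Suc h)) S \<Longrightarrow> z \<in> sp h (del S A) \<Longrightarrow> cyc h z \<Longrightarrow>
    \<exists>u\<in>sp (Suc h) (del S A). d h u = z"
  using assms
proof (induction A arbitrary: h S z rule: finite_ne_induct)
  case (singleton i)
  have "z \<in> sp h {..S - {i}}" using singleton(3) by (simp add: del_def)
  then obtain u where "u \<in> sp (Suc h) {..S - {i}}" "d h u = z"
    using dependent_exact[OF _ hits_remove[OF singleton(2)] _ singleton(4)] singleton(1) by blast
  then show ?case by (auto simp: del_def)
next
  case (insert j A)
  obtain x y where x: "x \<in> sp h (del S A)" and y: "y \<in> sp h {..S - {j}}"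
    and z: "z = (\<lambda>i. x i + y i)"
    using sp_Un insert.prems(3) unfolding del_insert by blast
  have S': "S - {j} \<subseteq> E" and h1: "hits \<B> (Suc h) (S - {j})"
    using insert.prems(1) hits_remove[OF insert.prems(2)] by auto
  \<comment> \<open>The summands of \<open>z\<close> need not be cycles. Their boundaries are
    opposite, hence lie in the intersection, where the induction hypothesis for
    \<open>S - {j}\<close> in one homological degree less provides a common correction
    \<open>w\<close>.\<close>
  obtain w where w: "w \<in> sp h (del (S - {j}) A)" "cyc h (\<lambda>i. x i - w i)" "cyc h (\<lambda>i. y i + w i)"
  proof (cases h)
    case 0
    then show ?thesis by (intro that[of "\<lambda>_. 0"] sp_I) auto
  next
    case (Suc q)
    have dz: "d q z = (\<lambda>_. 0)" using insert.prems(4) Suc by simp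
    have 1: "d q x = (\<lambda>i. 0 - d q y i)"
      using dz unfolding z d_add by (auto simp: fun_eq_iff eq_neg_iff_add_eq_0)
    have "d q x \<in> sp q (del S A)" using x del_down unfolding Suc by (rule d_sp)
    moreover have "d q y \<in> sp q {..S - {j}}" using y unfolding Suc by (rule d_sp) auto
    then have "d q x \<in> sp q {..S - {j}}" unfolding 1 by (rule sp_uminus)
    ultimately have dx: "d q x \<in> sp q (del (S - {j}) A)" unfolding sp_del_Int by blast
    have "x \<in> sp (Suc q) {..S}" using x sp_mono[OF del_subset] Suc by blast
    then have "cyc q (d q x)" using cyc_d[of S] insert.prems(1) by auto
    then obtain w where w: "w \<in> sp (Suc q) (del (S - {j}) A)" "d q w = d q x"
      using insert.IH[OF S' _ dx] h1 Suc by auto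
    show ?thesis
      by (rule that[of w]) (use w 1 Suc in \<open>auto simp: d_diff d_add\<close>)
  qed
  have w1: "w \<in> sp h (del S A)" "w \<in> sp h {..S - {j}}"
    using w(1) unfolding sp_del_Int by blast+
  \<comment> \<open>The corrected summands are filled separately: one by induction on
    \<open>A\<close>, the other because \<open>S - {j}\<close> still has positive nullity.\<close>
  obtain u where u: "u \<in> sp (Suc h) (del S A)" "d h u = (\<lambda>i. x i - w i)"
    using insert.IH[OF insert.prems(1,2) sp_diff[OF x w1(1)] w(2)] by auto
  obtain v where v: "v \<in> sp (Suc h) {..S - {j}}" "d h v = (\<lambda>i. y i + w i)"
    using dependent_exact[OF S' h1 sp_add[OF y w1(2)] w(3)] by blast
  have "u \<in> sp (Suc h) (del S (insert j A))" "v \<in> sp (Suc h) (del S (insert j A))"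
    using u(1) v(1) sp_mono[of _ "del S (insert j A)" "Suc h"] unfolding del_insert by blast+
  then show ?case
    by (intro bexI[of _ "\<lambda>i. u i + v i"] sp_add) (auto simp: d_add u v z)
qed

text \<open>The cycle is built by lifting along connecting homomorphisms, one element of
  \<open>S \<inter> B\<close> at a time. It starts from a generator of degree \<open>bot\<close>,
  which does not bound once the only element of \<open>S \<inter> B\<close> has been deleted, since
  what remains misses the basis \<open>B\<close>.\<close>

lemma del_not_exact:
  assumes "B \<in> \<B>"
  shows "S \<subseteq> E \<Longrightarrow> hits \<B> (Suc q) S \<Longrightarrow> card (S \<inter> B) = Suc q \<Longrightarrow>
    \<exists>z\<in>sp q (del S (S \<inter> B)). cyc q z \<and> (\<forall>u\<in>sp (Suc q) (del S (S \<inter> B)). d q u \<noteq> z)"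
proof (induction q arbitrary: S)
  case 0
  then obtain j where j: "S \<inter> B = {j}" by (auto simp: card_1_singleton_iff)
  then have "(S - {j}) \<inter> B = {}" by auto
  then have nh: "\<not> hits \<B> (Suc 0) (S - {j})" using assms unfolding hits_def by (metis card.empty not_one_le_zero One_nat_def)
  obtain i where i: "i < r 0" "dg 0 i = bot" "\<epsilon> i \<noteq> 0" using aug by auto
  have e: "unit i \<in> sp 0 {..S - {j}}" using i by (simp add: unit_sp)
  have "\<not> (\<exists>u\<in>sp 1 {..S - {j}}. d 0 u = unit i)"
    using exact0[OF _ e] 0 i nh sum_unit[of i \<epsilon>] by auto
  moreover have "del S (S \<inter> B) = {..S - {j}}" unfolding j by (simp add: del_def)
  ultimately show ?case using e cyc_simps(1) by (metis One_nat_def)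
next
  case (Suc q)
  have "S \<inter> B \<noteq> {}" using Suc.prems(3) card.empty by (metis nat.distinct(1))
  then obtain j where j: "j \<in> S \<inter> B" by blast
  \<comment> \<open>\<open>A\<close> is \<open>S \<inter> B\<close> without \<open>j\<close>, so the
    induction hypothesis applies to \<open>T\<close> with the same basis \<open>B\<close>.\<close>
  define T A where "T = S - {j}" and "A = T \<inter> B"
  have A: "S \<inter> B = insert j A" "j \<notin> A" using j by (auto simp: A_def T_def)
  have finS: "finite S" using Suc.prems finite_E finite_subset by blast
  have cA: "card A = Suc q" using Suc.prems(3) A finS by (simp add: A_def T_def)
  then have neA: "finite A" "A \<noteq> {}" by (auto intro: card_ge_0_finite)
  have T: "T \<subseteq> E" and hT: "hits \<B> (Suc q) T"
    using Suc.prems hits_remove by (auto simp: T_def)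
  obtain z where z: "z \<in> sp q (del T A)" "cyc q z"
    and nz: "\<And>u. u \<in> sp (Suc q) (del T A) \<Longrightarrow> d q u \<noteq> z"
    using Suc.IH[OF T hT] cA unfolding A_def by blast
  have z1: "z \<in> sp q (del S A)" "z \<in> sp q {..T}"
    using z(1) unfolding T_def del_Int[symmetric] sp_Int by auto
  obtain x where x: "x \<in> sp (Suc q) (del S A)" "d q x = z"
    using del_exact[OF neA Suc.prems(1,2) z1(1) z(2)] by auto
  obtain y where y: "y \<in> sp (Suc q) {..T}" "d q y = z"
    using dependent_exact[OF T hT z1(2) z(2)] by blast
  \<comment> \<open>Two fillings of \<open>z\<close>, one on each side of the cover, are glued to a
    cycle whose image under the connecting homomorphism is the class of \<open>z\<close>.\<close>
  define c where "c = (\<lambda>i. x i - y i)"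
  have "d (Suc q) u \<noteq> c" if "u \<in> sp (Suc (Suc q)) (del S (S \<inter> B))" for u
  proof
    assume uc: "d (Suc q) u = c"
    obtain u1 u2 where u1: "u1 \<in> sp (Suc (Suc q)) (del S A)"
      and u2: "u2 \<in> sp (Suc (Suc q)) {..T}" and u: "u = (\<lambda>i. u1 i + u2 i)"
      using \<open>u \<in> _\<close> sp_Un unfolding A(1) del_insert T_def by blast
    \<comment> \<open>Splitting a filling of \<open>c\<close> moves \<open>x\<close> and
      \<open>y\<close> to one chain \<open>v\<close> in the intersection, which would fill
      \<open>z\<close> there.\<close>
    define v where "v = (\<lambda>i. x i - d (Suc q) u1 i)"
    have v': "v = (\<lambda>i. y i + d (Suc q) u2 i)"
    proof
      fix i
      have "d (Suc q) u1 i + d (Suc q) u2 i = x i - y i"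
        using fun_cong[OF uc, of i] unfolding u d_add c_def .
      then show "v i = y i + d (Suc q) u2 i" unfolding v_def by (simp add: algebra_simps)
    qed
    have "v \<in> sp (Suc q) (del S A)"
      unfolding v_def by (rule sp_diff[OF x(1)], rule d_sp[OF u1]) (rule del_down)
    moreover have "v \<in> sp (Suc q) {..T}"
      unfolding v' by (rule sp_add[OF y(1)], rule d_sp[OF u2]) auto
    ultimately have "v \<in> sp (Suc q) (del T A)" unfolding T_def del_Int[symmetric] sp_Int by auto
    moreover have "d q (d (Suc q) u2) = (\<lambda>_. 0)" using cyc_d[OF _ u2] T by auto
    then have "d q v = z" unfolding v' d_add y by simp
    ultimately show False using nz by auto
  qed
  moreover have "c \<in> sp (Suc q) (del S (S \<inter> B))"
    unfolding c_def A(1) del_insert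
    using x(1) y(1) sp_mono[of _ "del S A \<union> {..S - {j}}" "Suc q"] unfolding T_def
    by (intro sp_diff) blast+
  moreover have "cyc (Suc q) c" by (simp add: c_def d_diff x y)
  ultimately show ?case by blast
qed

text \<open>The boundary of a basis element of degree \<open>S\<close> lives on proper subsets of
  \<open>S\<close>. If the nullity of \<open>S\<close> exceeded \<open>p\<close>,
  \<open>del_exact\<close> would fill it by chains on proper subsets, against minimality.\<close>

lemma not_hits_dg: "j < r p \<Longrightarrow> \<not> hits \<B> (Suc p) (dg p j)"
proof (cases p)
  case 0
  then show "j < r p \<Longrightarrow> ?thesis" using dg_0 bases(1) by (auto simp: hits_def)
next
  case (Suc q)
  define S where "S = dg p j"
  assume j: "j < r p"
  then have S: "S \<subseteq> E" using dg_in S_def by blast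
  show ?thesis
  proof
    assume "hits \<B> (Suc p) (dg p j)"
    then have hS: "hits \<B> (Suc (Suc q)) S" by (simp add: Suc S_def)
    obtain B where "B \<in> \<B>" using bases by auto
    then have neS: "S \<noteq> {}" "finite S"
      using hS S finite_E finite_subset by (auto simp: hits_def)
    define z where "z = d q (unit j)"
    have z: "z \<in> sp q (del S S)"
    proof (rule sp_I)
      fix i assume "z i \<noteq> 0"
      then obtain l where "i < r q" "unit j l \<noteq> 0" "dg q i < dg (Suc q) l"
        unfolding z_def by (rule d_support)
      then have "i < r q" "dg q i < S" by (auto simp: S_def Suc split: if_splits)
      then show "i < r q \<and> dg q i \<in> del S S" by (auto simp: del_def)
    qed
    have e: "unit j \<in> sp (Suc q) {..S}" using j unfolding Suc by (rule unit_sp) (simp add: S_def Suc)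
    have "cyc q z" unfolding z_def by (rule cyc_d[OF _ e]) (use S in auto)
    then obtain u where u: "u \<in> sp (Suc q) (del S S)" "d q u = z"
      using del_exact[OF neS(2,1) S hS z] by auto
    have "u j = 1" by (rule coeff_of_unit_boundary[of _ q])
        (use j u sp_mono[OF del_subset, of "Suc q"] in \<open>auto simp: S_def Suc z_def\<close>)
    then have "S \<in> del S S" using sp_D[OF u(1)] by (auto simp: S_def Suc)
    then show False by (auto simp: del_def)
  qed
qed

end

text \<open>The premises of \<open>coloop\<close> say that \<open>c\<close> is a coloop of
  \<open>S\<close> in the dual matroid: \<open>k\<close> is the nullity of \<open>S\<close>, and
  deleting \<open>c\<close> does not lower it. A coloop lies in no circuit, so a dependent subset of
  \<open>S\<close> stays dependent without it.\<close>

locale matroidal_resolution = set_resolution r dg \<delta> \<epsilon> E \<B> sp d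
  for r dg \<delta> \<epsilon> E \<B> sp d +
  assumes coloop: "S \<subseteq> E \<Longrightarrow> hits \<B> k S \<Longrightarrow> \<not> hits \<B> (Suc k) S \<Longrightarrow> hits \<B> k (S - {c}) \<Longrightarrow>
    c \<in> T \<Longrightarrow> T \<subseteq> S \<Longrightarrow> hits \<B> (Suc 0) T \<Longrightarrow> hits \<B> (Suc 0) (T - {c})"
begin

text \<open>Deleting a coloop does not change membership in the ideal, so
  \<open>degrees_fixed\<close> applies to deletion of \<open>c\<close> on the subsets of
  \<open>dg p j\<close>.\<close>

lemma no_coloop_dg:
  assumes j: "j < r p" and c: "c \<in> dg p j" and k: "hits \<B> k (dg p j)" "\<not> hits \<B> (Suc k) (dg p j)"
  shows "\<not> hits \<B> k (dg p j - {c})"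
proof
  assume hc: "hits \<B> k (dg p j - {c})"
  define S where "S = dg p j"
  have S: "S \<subseteq> E" using dg_in j S_def by auto
  have "dg p j - {c} = dg p j"
  proof (rule degrees_fixed[of "{..S}" "\<lambda>T. T - {c}"])
    fix T assume T: "T \<in> {..S}" "T \<in> {S. hits \<B> (Suc 0) S}"
    show "T - {c} \<in> {S. hits \<B> (Suc 0) S}"
    proof (cases "c \<in> T")
      case True
      then show ?thesis using coloop[OF S k[folded S_def] hc[folded S_def]] T by auto
    qed (use T in auto)
  qed (use S S_def j in auto)
  then show False using c by auto
qed

text \<open>The boundary of the basis element is nonzero and thus involves a proper subset of
  \<open>S\<close>, of nullity at least \<open>p\<close> by induction. It lies in some
  \<open>S - {c}\<close>, and as \<open>c\<close> is not a coloop, the nullity of \<open>S\<close>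
  is larger.\<close>

lemma hits_dg: "j < r p \<Longrightarrow> hits \<B> p (dg p j)"
proof (induction p arbitrary: j)
  case 0
  then show ?case by (simp add: hits_def)
next
  case (Suc p)
  define S where "S = dg (Suc p) j"
  obtain k where k: "hits \<B> k S" "\<not> hits \<B> (Suc k) S" using maximal_hits bases by blast
  obtain i where "d p (unit j) i \<noteq> 0" using unit_boundary_nonzero[OF Suc.prems] by auto
  then obtain l where "i < r p" "unit j l \<noteq> 0" "dg p i < dg (Suc p) l" by (rule d_support)
  then have i: "i < r p" "dg p i < S" by (auto simp: S_def split: if_splits)
  then obtain c where c: "c \<in> S" "dg p i \<subseteq> S - {c}" by blast
  have "\<not> hits \<B> k (S - {c})"
    using no_coloop_dg[OF Suc.prems] c k by (simp add: S_def)
  moreover have "finite S" using dg_in[OF Suc.prems] finite_E finite_subset S_def by blast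
  then have "hits \<B> p (S - {c})" using hits_mono[OF Suc.IH[OF i(1)] c(2)] by auto
  ultimately have "p < k" using hits_antimono not_le by blast
  then show ?case using hits_antimono[OF k(1)] by (simp add: S_def Suc_le_eq)
qed

text \<open>The two bounds make the nullity exactly \<open>p\<close>; minimality is then the absence
  of coloops.\<close>

lemma dg_minhits:
  assumes j: "j < r p"
  shows "dg p j \<in> minhits E \<B> p"
proof -
  define S where "S = dg p j"
  have S: "S \<subseteq> E" using dg_in j S_def by auto
  have h: "hits \<B> p S" "\<not> hits \<B> (Suc p) S" using hits_dg j not_hits_dg S_def by auto
  have "T = S" if T: "T \<subseteq> S" "hits \<B> p T" for T
  proof (rule ccontr)
    assume "T \<noteq> S"
    then obtain c where c: "c \<in> S" "T \<subseteq> S - {c}" using T by blast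
    have "finite S" using S finite_E finite_subset by blast
    then have "hits \<B> p (S - {c})" using hits_mono[OF T(2) c(2)] by auto
    then show False using no_coloop_dg[OF j] c h S_def by auto
  qed
  then show ?thesis using S h by (auto simp: minhits_def S_def)
qed

text \<open>Minimality makes the nullity exactly \<open>Suc q\<close>, attained at a basis
  \<open>B\<close>. The cycle from \<open>del_not_exact\<close> bounds in the strand of
  \<open>S\<close>, and only a basis element of degree \<open>S\<close> can be responsible for
  that.\<close>

lemma minhits_dg:
  assumes S: "S \<in> minhits E \<B> (Suc q)"
  shows "\<exists>j<r (Suc q). dg (Suc q) j = S"
proof (rule ccontr)
  assume no: "\<not> ?thesis"
  have SE: "S \<subseteq> E" and hS: "hits \<B> (Suc q) S"
    and m: "\<And>T. T \<subseteq> S \<Longrightarrow> hits \<B> (Suc q) T \<Longrightarrow> T = S" using S by (auto simp: minhits_def)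
  obtain B0 where "B0 \<in> \<B>" using bases by auto
  then have "S \<noteq> {}" using hS by (auto simp: hits_def)
  then obtain c where "c \<in> S" by auto
  then have "\<not> hits \<B> (Suc q) (S - {c})" using m by blast
  then have "\<not> hits \<B> (Suc (Suc q)) S" using hits_remove by blast
  then obtain B where B: "B \<in> \<B>" "card (S \<inter> B) = Suc q" using hS by (force simp: hits_def)
  obtain z where z: "z \<in> sp q (del S (S \<inter> B))" "cyc q z"
    and nz: "\<And>u. u \<in> sp (Suc q) (del S (S \<inter> B)) \<Longrightarrow> d q u \<noteq> z"
    using del_not_exact[OF B(1) SE hS B(2)] by blast
  have "z \<in> sp q {..S}" using z sp_mono[OF del_subset] by blast
  then obtain u where u: "u \<in> sp (Suc q) {..S}" "d q u = z"
    using dependent_exact[OF SE hS _ z(2)] by blast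
  \<comment> \<open>By \<open>hits_dg\<close> a degree inside \<open>S\<close> has nullity at least
    \<open>Suc q\<close>, so it equals \<open>S\<close>, which is assumed not to occur.\<close>
  have "u j = 0" for j
  proof (rule ccontr)
    assume "u j \<noteq> 0"
    then have j: "j < r (Suc q)" "dg (Suc q) j \<subseteq> S" using sp_D[OF u(1)] by auto
    then show False using m hits_dg no by blast
  qed
  then have "u \<in> sp (Suc q) (del S (S \<inter> B))" by (intro sp_I) auto
  then show False using nz u by auto
qed

theorem dg_image: "h \<ge> 1 \<Longrightarrow> dg h ` {0..<r h} = minhits E \<B> h"
  using dg_minhits minhits_dg by (cases h) (auto, metis atLeastLessThan_iff image_eqI zero_le)

end

subsection \<open>Basis exchange\<close>

text \<open>Each exchange preserves the cardinality of \<open>B1\<close> and shrinks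
  \<open>B1 - B2\<close>.\<close>

lemma bases_card_eq:
  assumes "matroid_bases n \<B>" "B1 \<in> \<B>" "B2 \<in> \<B>"
  shows "card B1 = card B2"
  using assms(2,3)
proof (induction "card (B1 - B2)" arbitrary: B1 rule: less_induct)
  case less
  have fin: "finite B" if "B \<in> \<B>" for B
    using assms(1) that finite_subset[of B "{1..n}"] by (auto simp: matroid_bases_def)
  have ex: "\<exists>y\<in>B2 - B1. insert y (B1 - {x}) \<in> \<B>" if "B1 \<in> \<B>" "B2 \<in> \<B>" "x \<in> B1 - B2" for x B1 B2
    using assms(1) that by (auto simp: matroid_bases_def)
  show ?case
  proof (cases "B1 \<subseteq> B2")
    case True
    then have "B2 \<subseteq> B1" using ex[OF less.prems(2,1)] by blast
    then show ?thesis using True by auto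
  next
    case False
    then obtain x where x: "x \<in> B1 - B2" by auto
    obtain y where y: "y \<in> B2 - B1" "insert y (B1 - {x}) \<in> \<B>" using ex[OF less.prems x] by auto
    have "insert y (B1 - {x}) - B2 = (B1 - B2) - {x}" using x y by auto
    then have "card (insert y (B1 - {x}) - B2) < card (B1 - B2)"
      using x fin[OF less.prems(1)] by (metis DiffD1 DiffD2 DiffI card_Diff1_less finite_Diff)
    then have "card (insert y (B1 - {x})) = card B2" using less.hyps y less.prems(2) by blast
    moreover have "card (insert y (B1 - {x})) = card B1" 
      using x y(1) fin[OF less.prems(1)] card_Suc_Diff1[of B1 x] by simp
    ultimately show ?thesis by simp
  qed
qed

text \<open>Among the bases meeting \<open>S\<close> in fewer elements than \<open>B\<close>, let
  \<open>C\<close> be closest to \<open>B\<close>. Then \<open>C - B\<close> avoids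
  \<open>S\<close>: exchanging an element of \<open>C - B\<close> in \<open>S\<close> for one of
  \<open>B\<close> would bring \<open>C\<close> closer without enlarging its intersection with
  \<open>S\<close>.\<close>

lemma bases_improve:
  assumes M: "matroid_bases n \<B>" and B: "B \<in> \<B>" and B2: "B2 \<in> \<B>"
    and lt: "card (S \<inter> B2) < card (S \<inter> B)"
  obtains x y where "x \<in> S \<inter> B" "y \<notin> S" "y \<notin> B" "insert y (B - {x}) \<in> \<B>"
proof -
  have fin: "finite B" if "B \<in> \<B>" for B
    using M that finite_subset[of B "{1..n}"] by (auto simp: matroid_bases_def)
  have ex: "\<exists>y\<in>B2 - B1. insert y (B1 - {x}) \<in> \<B>" if "B1 \<in> \<B>" "B2 \<in> \<B>" "x \<in> B1 - B2" for x B1 B2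
    using M that by (auto simp: matroid_bases_def)
  define Q where "Q = {B2 \<in> \<B>. card (S \<inter> B2) < card (S \<inter> B)}"
  have "B2 \<in> Q" using B2 lt by (simp add: Q_def)
  then obtain C where C: "C \<in> Q" and m: "\<And>D. D \<in> Q \<Longrightarrow> card (C - B) \<le> card (D - B)"
    using arg_min_nat_lemma[of "\<lambda>C. C \<in> Q" B2 "\<lambda>C. card (C - B)"] by blast
  have CB: "C \<in> \<B>" and Clt: "card (S \<inter> C) < card (S \<inter> B)" using C by (auto simp: Q_def)
  have "(C - B) \<inter> S = {}"
  proof (rule ccontr)
    assume "(C - B) \<inter> S \<noteq> {}"
    then obtain z where z: "z \<in> C - B" "z \<in> S" by auto
    then obtain w where w: "w \<in> B - C" "insert w (C - {z}) \<in> \<B>" using ex[OF CB B] by auto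
    have "S \<inter> insert w (C - {z}) \<subseteq> insert w (S \<inter> C - {z})" by auto
    then have "card (S \<inter> insert w (C - {z})) \<le> card (insert w (S \<inter> C - {z}))"
      by (rule card_mono[rotated]) (use fin[OF CB] in auto)
    also have "\<dots> = card (S \<inter> C)"
      using w z fin[OF CB] card_Suc_Diff1[of "S \<inter> C" z] by simp
    finally have "insert w (C - {z}) \<in> Q" using w Clt by (simp add: Q_def)
    then have "card (C - B) \<le> card (insert w (C - {z}) - B)" by (rule m)
    moreover have "insert w (C - {z}) - B = (C - B) - {z}" using w by auto
    then have "card (insert w (C - {z}) - B) < card (C - B)"
      using z fin[OF CB] by (metis DiffD1 DiffD2 DiffI card_Diff1_less finite_Diff)
    ultimately show False by simp
  qed
  then have CS: "C - B \<subseteq> - S" by auto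
  \<comment> \<open>An element of \<open>S \<inter> B\<close> outside \<open>C\<close> is then
    exchanged for one of \<open>C - B\<close>, which lies outside \<open>S\<close>.\<close>
  have "\<not> S \<inter> B \<subseteq> C"
  proof
    assume "S \<inter> B \<subseteq> C"
    then have "S \<inter> B \<subseteq> S \<inter> C" by auto
    then have "card (S \<inter> B) \<le> card (S \<inter> C)" using fin[OF CB] by (simp add: card_mono)
    then show False using Clt by simp
  qed
  then obtain x where x: "x \<in> S \<inter> B" "x \<notin> C" by auto
  then obtain y where "y \<in> C - B" "insert y (B - {x}) \<in> \<B>" using ex[OF B CB] by auto
  then show ?thesis using that x CS by auto
qed

text \<open>A basis avoiding \<open>T - {c}\<close> contains \<open>c\<close>, because
  \<open>T\<close> meets every basis. Take such a \<open>B\<close> with the smallest intersection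
  with \<open>S - {c}\<close>. It meets \<open>S\<close> in more than \<open>k\<close> elements, so
  \<open>bases_improve\<close> exchanges some \<open>x\<close> for some \<open>y\<close> outside
  \<open>S\<close>, and the new basis still avoids \<open>T - {c}\<close>. If \<open>x = c\<close>,
  it also loses \<open>c\<close>; otherwise it contradicts the choice of \<open>B\<close>.\<close>

lemma matroid_coloop:
  assumes M: "matroid_bases n \<B>" and S: "finite S"
    and k: "hits \<B> k S" "\<not> hits \<B> (Suc k) S" "hits \<B> k (S - {c})"
    and T: "c \<in> T" "T \<subseteq> S" "hits \<B> (Suc 0) T"
  shows "hits \<B> (Suc 0) (T - {c})"
proof (rule ccontr)
  assume nh: "\<not> hits \<B> (Suc 0) (T - {c})"
  have fin: "finite B" if "B \<in> \<B>" for B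
    using M that finite_subset[of B "{1..n}"] by (auto simp: matroid_bases_def)
  have finT: "finite T" using T S finite_subset by blast
  define S' where "S' = S - {c}"
  have dj: "c \<in> B" if "B \<in> \<B>" "(T - {c}) \<inter> B = {}" for B
    using T hits_1[OF finT] that by blast
  define Q where "Q = {B \<in> \<B>. (T - {c}) \<inter> B = {}}"
  obtain B1 where "B1 \<in> Q" using nh hits_1[of "T - {c}" \<B>] finT by (auto simp: Q_def)
  then obtain B where BQ: "B \<in> Q" and m: "\<And>D. D \<in> Q \<Longrightarrow> card (S' \<inter> B) \<le> card (S' \<inter> D)"
    using arg_min_nat_lemma[of "\<lambda>C. C \<in> Q" B1 "\<lambda>C. card (S' \<inter> C)"] by blast
  have B: "B \<in> \<B>" "(T - {c}) \<inter> B = {}" "c \<in> B" using BQ dj by (auto simp: Q_def)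
  have swap: "card (S' \<inter> insert y (B - {x})) < card (S' \<inter> B)" if "x \<in> S' \<inter> B" "y \<notin> S'" for x y
  proof -
    have "S' \<inter> insert y (B - {x}) = S' \<inter> B - {x}" using that by auto
    then show ?thesis using that fin[OF B(1)] by (metis card_Diff1_less finite_Int)
  qed
  obtain B3 where B3: "B3 \<in> \<B>" "card (S \<inter> B3) \<le> k" using k(2) by (auto simp: hits_def not_le less_Suc_eq_le)
  have cS: "card (S \<inter> B) = Suc (card (S' \<inter> B))"
  proof -
    have "S \<inter> B = insert c (S' \<inter> B)" "c \<notin> S' \<inter> B" using B T by (auto simp: S'_def)
    then show ?thesis using fin[OF B(1)] by simp
  qed
  have ge: "k \<le> card (S' \<inter> D)" if "D \<in> \<B>" for D using k(3) that by (auto simp: hits_def S'_def)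
  then have "card (S \<inter> B3) < card (S \<inter> B)" using B B3 cS by (simp add: less_Suc_eq_le le_trans)
  then obtain x y where xy: "x \<in> S \<inter> B" "y \<notin> S" "y \<notin> B" "insert y (B - {x}) \<in> \<B>"
    using bases_improve[OF M B(1) B3(1)] by blast
  have dT: "(T - {c}) \<inter> insert y (B - {x}) = {}" using B(2) xy(2) T(2) by auto
  show False
  proof (cases "x = c")
    case True
    then show False using dj[OF xy(4) dT] xy B by auto
  next
    case False
    then have "x \<in> S' \<inter> B" "y \<notin> S'" using xy by (auto simp: S'_def)
    then show False using swap m[of "insert y (B - {x})"] xy dT Q_def by fastforce
  qed
qed

subsection \<open>Squarefree monomials\<close>

abbreviation (input) lk where "lk \<equiv> Poly_Mapping.lookup"
abbreviation (input) keys where "keys \<equiv> Poly_Mapping.keys"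
abbreviation (input) single where "single \<equiv> Poly_Mapping.single"

lemma keys_monom_add: "keys (a + b :: monom) = keys a \<union> keys b"
  by (auto simp: in_keys_iff lookup_add)

lemma monom_dvd_iff: "monom_dvd b a \<longleftrightarrow> (\<exists>c. a = b + c)"
proof
  assume "monom_dvd b a"
  then have "a = b + (a - b)"
    by (intro poly_mapping_eqI) (simp add: lookup_add lookup_minus monom_dvd_def)
  then show "\<exists>c. a = b + c" by blast
qed (auto simp: monom_dvd_def lookup_add)

lemma monom_dvd_diff: "monom_dvd b a \<Longrightarrow> b + (a - b) = a"
  by (auto simp: monom_dvd_iff)

lemma keys_monom_dvd: "monom_dvd b a \<Longrightarrow> keys b \<subseteq> keys a"
  by (auto simp: monom_dvd_iff keys_monom_add)

lemma lookup_single_times: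
  fixes w :: "'k::field mpoly"
  shows "lk (single m k * w) (m + s) = k * lk w s"
proof -
  have "lk (single m k * w) (m + s) = (\<Sum>l. (k when m = l) * (\<Sum>q. lk w q when m + s = l + q))"
    by (simp add: lookup_mult lookup_single)
  also have "\<dots> = k * (\<Sum>q. lk w q when m + s = m + q)"
    by (simp add: when_mult)
  also have "(\<Sum>q. lk w q when m + s = m + q) = lk w s" by simp
  finally show ?thesis .
qed

lemma poly_mapping_sum_single: "(\<Sum>m\<in>keys p. single m (lk p m)) = p"
proof (rule poly_mapping_eqI)
  fix k
  show "lk (\<Sum>m\<in>keys p. single m (lk p m)) k = lk p k"
    by (auto simp: lookup_sum lookup_single when_def in_keys_iff)
qed

definition sqmon :: "nat set \<Rightarrow> monom" where
  "sqmon T = (\<Sum>i\<in>T. single i 1)"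

lemma lookup_sqmon: "finite T \<Longrightarrow> lk (sqmon T) i = (if i \<in> T then 1 else 0)"
  by (simp add: sqmon_def lookup_sum lookup_single when_def)

lemma keys_sqmon: "finite T \<Longrightarrow> keys (sqmon T) = T"
  by (auto simp: in_keys_iff lookup_sqmon split: if_splits)

lemma squarefree_sqmon: "finite T \<Longrightarrow> squarefree_monom (sqmon T)"
  by (simp add: squarefree_monom_def lookup_sqmon)

lemma sqmon_dvd_iff: "finite T \<Longrightarrow> monom_dvd (sqmon T) a \<longleftrightarrow> T \<subseteq> keys a"
  by (auto simp: monom_dvd_def lookup_sqmon in_keys_iff Suc_le_eq)

lemma squarefree_lookup: "squarefree_monom a \<Longrightarrow> lk a i = (if i \<in> keys a then 1 else 0)"
  unfolding squarefree_monom_def in_keys_iff by (metis le_antisym less_one linorder_not_less)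

lemma squarefree_eq_iff: "squarefree_monom a \<Longrightarrow> squarefree_monom b \<Longrightarrow> a = b \<longleftrightarrow> keys a = keys b"
  by (metis poly_mapping_eqI squarefree_lookup)

lemma squarefree_eq_sqmon: "squarefree_monom a \<Longrightarrow> a = sqmon (keys a)"
  by (simp add: squarefree_eq_iff squarefree_sqmon keys_sqmon)

lemma monomial_mult: "monomial a * monomial b = (monomial (a + b) :: 'k::field mpoly)"
  by (simp add: monomial_def mult_single)

lemma prod_var: "finite T \<Longrightarrow> (\<Prod>i\<in>T. var i) = (monomial (sqmon T) :: 'k::field mpoly)"
  by (induction T rule: finite_induct) (simp_all add: sqmon_def var_def monomial_mult, simp add: monomial_def)

subsection \<open>Ideals of monomial type\<close>

text \<open>Monomial ideals are encoded by a predicate on exponents, so membership is tested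
  monomial by monomial. The result is an ideal once \<open>P\<close> is stable under
  multiplication.\<close>

definition mon_ideal :: "nat \<Rightarrow> (monom \<Rightarrow> bool) \<Rightarrow> ('k::field) mpoly set" where
  "mon_ideal n P = {p \<in> polyring n. \<forall>m\<in>keys p. P m}"

lemma mon_ideal_D: "p \<in> mon_ideal n P \<Longrightarrow> m \<in> keys p \<Longrightarrow> P m"
  by (simp add: mon_ideal_def)

lemma polyring_mult: "p \<in> polyring n \<Longrightarrow> q \<in> polyring n \<Longrightarrow> p * q \<in> polyring n"
  unfolding polyring_def using keys_mult[of p q] by (fastforce simp: keys_monom_add)

lemma polyring_add: "p \<in> polyring n \<Longrightarrow> q \<in> polyring n \<Longrightarrow> p + q \<in> polyring n"
  unfolding polyring_def using Poly_Mapping.keys_add[of p q] by blast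

lemma polyring_sum: "(\<And>i. i \<in> A \<Longrightarrow> f i \<in> polyring n) \<Longrightarrow> sum f A \<in> polyring n"
  by (induction A rule: infinite_finite_induct) (simp_all add: polyring_add, simp_all add: polyring_def)

lemma polyring_single: "keys m \<subseteq> {1..n} \<Longrightarrow> single m k \<in> polyring n"
  by (simp add: polyring_def)

lemma monomial_polyring: "monomial a \<in> polyring n \<longleftrightarrow> keys a \<subseteq> {1..n}"
  by (simp add: polyring_def monomial_def)

lemma monomial_mon_ideal: "monomial a \<in> mon_ideal n P \<longleftrightarrow> keys a \<subseteq> {1..n} \<and> P a"
  by (simp add: mon_ideal_def polyring_def monomial_def)

lemma is_ideal_mon_ideal:
  assumes "\<And>a b. P b \<Longrightarrow> P (a + b)"
  shows "is_ideal n (mon_ideal n P)"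
  unfolding is_ideal_def
proof (intro conjI ballI)
  fix a b :: "'a mpoly" assume "a \<in> mon_ideal n P" "b \<in> mon_ideal n P"
  then show "a + b \<in> mon_ideal n P"
    unfolding mon_ideal_def using polyring_add[of a n b] Poly_Mapping.keys_add[of a b] by blast
next
  fix a b :: "'a mpoly" assume "a \<in> polyring n" "b \<in> mon_ideal n P"
  then show "a * b \<in> mon_ideal n P"
    unfolding mon_ideal_def using polyring_mult[of a n b] keys_mult[of a b] assms by blast
qed (auto simp: mon_ideal_def polyring_def)

lemma ideal_sum: "is_ideal n I \<Longrightarrow> (\<And>i. i \<in> A \<Longrightarrow> f i \<in> I) \<Longrightarrow> sum f A \<in> I"
  by (induction A rule: infinite_finite_induct) (auto simp: is_ideal_def)

lemma ideal_gen_least: "is_ideal n I \<Longrightarrow> S \<subseteq> I \<Longrightarrow> ideal_gen n S \<subseteq> I"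
  by (auto simp: ideal_gen_def)

lemma ideal_gen_superset: "S \<subseteq> ideal_gen n S"
  by (auto simp: ideal_gen_def)

text \<open>For \<open>S\<close> inside the ring, the ring itself is an ideal containing
  \<open>S\<close>, so the defining intersection is not over the empty family.\<close>

lemma is_ideal_ideal_gen:
  assumes "S \<subseteq> polyring n"
  shows "is_ideal n (ideal_gen n S :: 'a::field mpoly set)"
proof -
  have "polyring n = (mon_ideal n (\<lambda>_. True) :: 'a mpoly set)" by (simp add: mon_ideal_def)
  then have "is_ideal n (polyring n :: 'a mpoly set)" by (simp add: is_ideal_mon_ideal)
  then have "ideal_gen n S \<subseteq> polyring n" using assms by (rule ideal_gen_least)
  then show ?thesis unfolding is_ideal_def ideal_gen_def by auto
qed

text \<open>A polynomial is the sum of its terms, and each term is a multiple of a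
  generator.\<close>

lemma ideal_gen_monomials:
  assumes "\<And>a. a \<in> M \<Longrightarrow> keys a \<subseteq> {1..n}"
  shows "ideal_gen n (monomial ` M) = (mon_ideal n (\<lambda>m. \<exists>a\<in>M. monom_dvd a m) :: 'k::field mpoly set)"
proof
  have "is_ideal n (mon_ideal n (\<lambda>m. \<exists>a\<in>M. monom_dvd a m))"
    by (rule is_ideal_mon_ideal) (auto simp: monom_dvd_def lookup_add intro: trans_le_add2)
  then show "ideal_gen n (monomial ` M) \<subseteq> (mon_ideal n (\<lambda>m. \<exists>a\<in>M. monom_dvd a m) :: 'k mpoly set)"
    by (rule ideal_gen_least) (use assms in \<open>auto simp: monomial_mon_ideal monom_dvd_def\<close>)
next
  let ?I = "ideal_gen n (monomial ` M) :: 'k mpoly set"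
  have I: "is_ideal n ?I"
    by (rule is_ideal_ideal_gen) (use assms in \<open>auto simp: monomial_polyring\<close>)
  show "mon_ideal n (\<lambda>m. \<exists>a\<in>M. monom_dvd a m) \<subseteq> ?I"
  proof
    fix p :: "'k mpoly" assume p: "p \<in> mon_ideal n (\<lambda>m. \<exists>a\<in>M. monom_dvd a m)"
    have "single m (lk p m) \<in> ?I" if m: "m \<in> keys p" for m
    proof -
      obtain a where a: "a \<in> M" "monom_dvd a m" using mon_ideal_D[OF p m] by auto
      have "keys m \<subseteq> {1..n}" using p m by (auto simp: mon_ideal_def polyring_def)
      then have "keys (m - a) \<subseteq> {1..n}"
        using monom_dvd_diff[OF a(2)] keys_monom_add[of a "m - a"] by auto
      then have "single (m - a) (lk p m) * monomial a \<in> ?I"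
        using I ideal_gen_superset[of "monomial ` M" n] a(1) polyring_single
        unfolding is_ideal_def by blast
      then show ?thesis using monom_dvd_diff[OF a(2)] by (simp add: monomial_def mult_single add.commute)
    qed
    then show "p \<in> ?I" using ideal_sum[OF I, of "keys p" "\<lambda>m. single m (lk p m)"]
      by (simp add: poly_mapping_sum_single)
  qed
qed

lemma prime_of_eq:
  assumes "F \<subseteq> {1..n}"
  shows "(prime_of n F :: 'k::field mpoly set) = mon_ideal n (\<lambda>m. keys m \<inter> F \<noteq> {})"
proof -
  have "var ` F = (monomial ` (\<lambda>i. single i 1) ` F :: 'k mpoly set)"
    by (auto simp: var_def)
  moreover have "(\<exists>a\<in>(\<lambda>i. single i 1) ` F. monom_dvd a m) \<longleftrightarrow> keys m \<inter> F \<noteq> {}" for m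
    using sqmon_dvd_iff[of "{_}" m] by (auto simp: sqmon_def)
  moreover have "keys a \<subseteq> {1..n}" if "a \<in> (\<lambda>i. single i 1) ` F" for a :: monom
    using that assms by auto
  ultimately show ?thesis
    unfolding prime_of_def using ideal_gen_monomials[of "(\<lambda>i. single i 1) ` F" n] by simp
qed

text \<open>Split each factor into its terms free of the variables in \<open>F\<close>
  (\<open>good\<close>) and the others (\<open>bad\<close>), which lie in the ideal. The product of
  the good parts is in the ideal and free of \<open>F\<close>, hence zero, and the polynomial ring
  is a domain.\<close>

lemma is_prime_ideal_prime_of:
  assumes F: "F \<subseteq> {1..n}"
  shows "is_prime_ideal n (prime_of n F :: 'k::field mpoly set)"
proof -
  let ?P = "mon_ideal n (\<lambda>m. keys m \<inter> F \<noteq> {}) :: 'k mpoly set"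
  have I: "is_ideal n ?P" by (rule is_ideal_mon_ideal) (auto simp: keys_monom_add)
  have ne: "?P \<noteq> polyring n"
  proof -
    have "(monomial 0 :: 'k mpoly) \<in> polyring n" "(monomial 0 :: 'k mpoly) \<notin> ?P"
      by (simp_all add: monomial_polyring monomial_mon_ideal)
    then show ?thesis by blast
  qed
  define good where "good p = (\<Sum>m\<in>{m\<in>keys p. keys m \<inter> F = {}}. single m (lk p m))" for p :: "'k mpoly"
  define bad where "bad p = (\<Sum>m\<in>{m\<in>keys p. keys m \<inter> F \<noteq> {}}. single m (lk p m))" for p :: "'k mpoly"
  have split: "p = good p + bad p" for p
  proof -
    have "keys p = {m\<in>keys p. keys m \<inter> F = {}} \<union> {m\<in>keys p. keys m \<inter> F \<noteq> {}}" by auto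
    then have "(\<Sum>m\<in>keys p. single m (lk p m)) = good p + bad p"
      unfolding good_def bad_def by (subst sum.union_disjoint[symmetric]) auto
    then show ?thesis by (simp add: poly_mapping_sum_single)
  qed
  have bad: "bad p \<in> ?P" if "p \<in> polyring n" for p
    unfolding bad_def using that
    by (intro ideal_sum[OF I]) (auto simp: mon_ideal_def polyring_def)
  have good: "good p \<in> polyring n" if "p \<in> polyring n" for p
    unfolding good_def by (intro polyring_sum polyring_single) (use that in \<open>auto simp: polyring_def\<close>)
  have good_keys: "keys m \<inter> F = {}" if "m \<in> keys (good p)" for p m
  proof -
    have "lk (good p) m \<noteq> 0" using that by (simp add: in_keys_iff)
    then show ?thesis unfolding good_def
      by (auto simp: lookup_sum lookup_single when_def in_keys_iff elim!: sum.not_neutral_contains_not_neutral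
          split: if_splits)
  qed
  have "a \<in> ?P \<or> b \<in> ?P" if a: "a \<in> polyring n" and b: "b \<in> polyring n" and ab: "a * b \<in> ?P" for a b
  proof -
    have "good a * bad b + bad a * b \<in> ?P"
      using I bad[OF a] bad[OF b] good[OF a] b unfolding is_ideal_def by (metis mult.commute)
    \<comment> \<open>\<open>is_ideal\<close> speaks of sums and multiples, so subtraction is done
      by multiplying with -1.\<close>
    moreover have "- 1 \<in> polyring n" using polyring_single[of 0 n "-1"] by (simp add: single_uminus)
    ultimately have "a * b + - 1 * (good a * bad b + bad a * b) \<in> ?P"
      using I ab unfolding is_ideal_def by blast
    moreover have "a * b + - 1 * (good a * bad b + bad a * b) = good a * good b"
    proof -
      have "a * b = good a * good b + good a * bad b + bad a * b"
        using split[of a] split[of b] by (metis distrib_left distrib_right)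
      then show ?thesis by simp
    qed
    ultimately have in_P: "good a * good b \<in> ?P" by simp
    have "keys (good a * good b) = {}"
    proof (rule ccontr)
      assume "keys (good a * good b) \<noteq> {}"
      then obtain m where m: "m \<in> keys (good a * good b)" by blast
      then obtain x y where "m = x + y" "x \<in> keys (good a)" "y \<in> keys (good b)"
        using keys_mult by blast
      then have "keys m \<inter> F = {}" using good_keys by (auto simp: keys_monom_add)
      then show False using mon_ideal_D[OF in_P m] by simp
    qed
    then have "good a * good b = 0" by simp
    then have "good a = 0 \<or> good b = 0" by simp
    then show ?thesis using split bad a b by (metis add_0)
  qed
  then show ?thesis unfolding prime_of_eq[OF F] is_prime_ideal_def using I ne by blast
qed

lemma prime_prod_var:
  assumes Q: "is_prime_ideal n (Q :: 'k::field mpoly set)" and T: "finite T" "T \<subseteq> {1..n}"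
    and m: "(monomial (sqmon T) :: 'k mpoly) \<in> Q"
  shows "\<exists>i\<in>T. (var i :: 'k mpoly) \<in> Q"
  using T m
proof (induction T rule: finite_induct)
  case empty
  have "1 \<in> Q" using empty by (simp add: sqmon_def monomial_def)
  then have "r \<in> Q" if "r \<in> polyring n" for r
    using Q that unfolding is_prime_ideal_def is_ideal_def by (metis mult.right_neutral)
  then show ?case using Q by (auto simp: is_prime_ideal_def is_ideal_def)
next
  case (insert i T)
  have "var i * monomial (sqmon T) \<in> Q"
    using insert by (simp add: sqmon_def var_def monomial_mult)
  moreover have "var i \<in> polyring n" "monomial (sqmon T) \<in> polyring n"
    using insert by (auto simp: var_def monomial_polyring keys_sqmon)
  ultimately have "var i \<in> Q \<or> monomial (sqmon T) \<in> Q"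
    using Q unfolding is_prime_ideal_def by blast
  then show ?case using insert by auto
qed

section \<open>Minimal primes of the cover ideal\<close>

locale matroid =
  fixes n :: nat and \<B> :: "nat set set"
  assumes M: "matroid_bases n \<B>"
begin

lemma bases_sub: "B \<in> \<B> \<Longrightarrow> B \<subseteq> {1..n}" and nonempty: "\<B> \<noteq> {}"
  using M by (auto simp: matroid_bases_def)

lemma cover_ideal_eq:
  "(cover_ideal n \<B> :: 'k::field mpoly set) = mon_ideal n (\<lambda>m. hits \<B> (Suc 0) (keys m))"
  unfolding cover_ideal_def using bases_sub by (auto simp: prime_of_eq mon_ideal_def hits_1)

text \<open>Bases have equal cardinality and so form an antichain; hence every basis gives a minimal
  prime.\<close>

lemma prime_of_subset_iff:
  "B \<in> \<B> \<Longrightarrow> B' \<in> \<B> \<Longrightarrow> prime_of n B \<subseteq> (prime_of n B' :: 'k::field mpoly set) \<longleftrightarrow> B = B'"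
proof
  assume B: "B \<in> \<B>" "B' \<in> \<B>" and sub: "prime_of n B \<subseteq> (prime_of n B' :: 'k mpoly set)"
  have "i \<in> B'" if i: "i \<in> B" for i
  proof -
    have "(var i :: 'k mpoly) \<in> prime_of n B"
      using ideal_gen_superset[of "var ` B" n] i by (auto simp: prime_of_def)
    then have "(var i :: 'k mpoly) \<in> prime_of n B'" using sub by blast
    then show ?thesis using bases_sub[OF B(2)] by (auto simp: prime_of_eq var_def monomial_mon_ideal)
  qed
  moreover have "finite B'" using bases_sub[OF B(2)] finite_subset by blast
  ultimately show "B = B'" using bases_card_eq[OF M B] card_subset_eq[of B' B] by auto
qed simp

text \<open>The product of the variables outside the prime \<open>Q\<close> is not in
  \<open>Q\<close>, hence not in the cover ideal. So some basis avoids all these variables, and its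
  own variables lie in \<open>Q\<close>.\<close>

lemma prime_contains_prime_of:
  assumes Q: "is_prime_ideal n (Q :: 'k::field mpoly set)" "cover_ideal n \<B> \<subseteq> Q"
  obtains B where "B \<in> \<B>" "prime_of n B \<subseteq> Q"
proof -
  define T where "T = {i\<in>{1..n}. (var i :: 'k mpoly) \<notin> Q}"
  have T: "finite T" "T \<subseteq> {1..n}" by (auto simp: T_def)
  have "(monomial (sqmon T) :: 'k mpoly) \<notin> Q" using prime_prod_var[OF Q(1) T] by (auto simp: T_def)
  then have "(monomial (sqmon T) :: 'k mpoly) \<notin> cover_ideal n \<B>" using Q(2) by blast
  then obtain B where B: "B \<in> \<B>" "T \<inter> B = {}"
    using T by (auto simp: cover_ideal_eq monomial_mon_ideal hits_1 keys_sqmon)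
  have "var i \<in> Q" if "i \<in> B" for i
    using bases_sub[OF B(1)] B(2) that unfolding T_def by blast
  then have "var ` B \<subseteq> Q" by blast
  then have "prime_of n B \<subseteq> Q" unfolding prime_of_def
    using Q(1) by (intro ideal_gen_least) (simp_all add: is_prime_ideal_def)
  then show ?thesis using that B by blast
qed

lemma minimal_primes_eq: "minimal_primes n (cover_ideal n \<B> :: 'k::field mpoly set) = prime_of n ` \<B>"
proof
  show "minimal_primes n (cover_ideal n \<B> :: 'k mpoly set) \<subseteq> prime_of n ` \<B>"
  proof
    fix P assume P: "P \<in> minimal_primes n (cover_ideal n \<B> :: 'k mpoly set)"
    then obtain B where B: "B \<in> \<B>" "prime_of n B \<subseteq> P"
      using prime_contains_prime_of unfolding minimal_primes_def by blast
    have "cover_ideal n \<B> \<subseteq> prime_of n B" using B by (auto simp: cover_ideal_def)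
    then have "prime_of n B = P"
      using P B is_prime_ideal_prime_of[OF bases_sub[OF B(1)]] unfolding minimal_primes_def by blast
    then show "P \<in> prime_of n ` \<B>" using B by blast
  qed
next
  have "Q = prime_of n B" if B: "B \<in> \<B>"
    and Q: "is_prime_ideal n Q" "cover_ideal n \<B> \<subseteq> Q" "Q \<subseteq> prime_of n B" for B and Q :: "'k mpoly set"
  proof -
    obtain B' where B': "B' \<in> \<B>" "prime_of n B' \<subseteq> Q" using prime_contains_prime_of[OF Q(1,2)] by blast
    then have "B' = B" using prime_of_subset_iff[OF B'(1) B, where 'k = 'k] Q(3) by blast
    then show ?thesis using B' Q by blast
  qed
  then show "prime_of n ` \<B> \<subseteq> minimal_primes n (cover_ideal n \<B> :: 'k mpoly set)"
    using is_prime_ideal_prime_of[OF bases_sub] unfolding minimal_primes_def cover_ideal_def by blast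
qed

end

section \<open>Squarefree monomials in powers of the minimal primes\<close>

lemma prod_list_mon_ideal:
  assumes F: "F \<subseteq> {1..n}"
  shows "set xs \<subseteq> prime_of n F \<Longrightarrow>
    prod_list xs \<in> (mon_ideal n (\<lambda>m. length xs \<le> (\<Sum>i\<in>F. lk m i)) :: 'k::field mpoly set)"
proof (induction xs)
  case Nil
  then show ?case by (simp add: mon_ideal_def polyring_def)
next
  case (Cons x xs)
  have x: "x \<in> mon_ideal n (\<lambda>m. keys m \<inter> F \<noteq> {})" using Cons.prems by (simp add: prime_of_eq[OF F])
  have xs: "prod_list xs \<in> mon_ideal n (\<lambda>m. length xs \<le> (\<Sum>i\<in>F. lk m i))" using Cons by simp
  have "length (x # xs) \<le> (\<Sum>i\<in>F. lk m i)" if m: "m \<in> keys (x * prod_list xs)" for m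
  proof -
    obtain a b where ab: "m = a + b" "a \<in> keys x" "b \<in> keys (prod_list xs)"
      using keys_mult m by blast
    have finF: "finite F" using F finite_subset by blast
    \<comment> \<open>Each factor raises the degree in the variables of \<open>F\<close> by at least
      one.\<close>
    obtain i where "i \<in> F" "lk a i \<noteq> 0"
      using mon_ideal_D[OF x ab(2)] by (auto simp: in_keys_iff)
    then have "1 \<le> (\<Sum>i\<in>F. lk a i)" using member_le_sum[of i F "lk a"] finF by simp
    moreover have "length xs \<le> (\<Sum>i\<in>F. lk b i)" using mon_ideal_D[OF xs ab(3)] .
    ultimately show ?thesis by (simp add: ab lookup_add sum.distrib)
  qed
  moreover have "x * prod_list xs \<in> polyring n" using x xs by (simp add: mon_ideal_def polyring_mult)
  ultimately show ?case by (simp add: mon_ideal_def)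
qed

text \<open>Monomials in the power have degree at least \<open>h\<close> in the variables of
  \<open>F\<close>, which for squarefree \<open>a\<close> is
  \<open>card (keys a \<inter> F)\<close>. Conversely, \<open>h\<close> distinct variables from
  \<open>keys a \<inter> F\<close> multiply to a divisor of \<open>a\<close>.\<close>

lemma squarefree_monomial_ideal_pow:
  assumes F: "F \<subseteq> {1..n}" and a: "squarefree_monom a"
  shows "(monomial a :: 'k::field mpoly) \<in> ideal_pow n (prime_of n F) h \<longleftrightarrow>
    keys a \<subseteq> {1..n} \<and> h \<le> card (keys a \<inter> F)"
proof
  have finF: "finite F" using F finite_subset by blast
  have sub: "{prod_list xs |xs. length xs = h \<and> set xs \<subseteq> prime_of n F} \<subseteq>
      (mon_ideal n (\<lambda>m. h \<le> (\<Sum>i\<in>F. lk m i)) :: 'k mpoly set)"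
    using prod_list_mon_ideal[OF F] by blast
  have "is_ideal n (mon_ideal n (\<lambda>m. h \<le> (\<Sum>i\<in>F. lk m i)) :: 'k mpoly set)"
    by (rule is_ideal_mon_ideal) (simp add: lookup_add sum.distrib)
  from ideal_gen_least[OF this sub]
  have "ideal_pow n (prime_of n F) h \<subseteq> (mon_ideal n (\<lambda>m. h \<le> (\<Sum>i\<in>F. lk m i)) :: 'k mpoly set)"
    unfolding ideal_pow_def .
  moreover assume "(monomial a :: 'k mpoly) \<in> ideal_pow n (prime_of n F) h"
  ultimately have "(monomial a :: 'k mpoly) \<in> mon_ideal n (\<lambda>m. h \<le> (\<Sum>i\<in>F. lk m i))" by blast
  then have *: "keys a \<subseteq> {1..n}" "h \<le> (\<Sum>i\<in>F. lk a i)" by (simp_all add: monomial_mon_ideal)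
  have "(\<Sum>i\<in>F. lk a i) = (\<Sum>i\<in>F. if i \<in> keys a then 1 else 0)"
    using squarefree_lookup[OF a] by (intro sum.cong) auto
  also have "\<dots> = card (keys a \<inter> F)"
    by (simp add: sum.If_cases[OF finF] Int_commute)
  finally show "keys a \<subseteq> {1..n} \<and> h \<le> card (keys a \<inter> F)" using * by simp
next
  let ?S = "{prod_list xs |xs. length xs = h \<and> set xs \<subseteq> prime_of n F} :: 'k mpoly set"
  assume *: "keys a \<subseteq> {1..n} \<and> h \<le> card (keys a \<inter> F)"
  then obtain T where T: "T \<subseteq> keys a \<inter> F" "card T = h" "finite T"
    by (meson obtain_subset_with_card_n)
  define xs where "xs = map (var :: nat \<Rightarrow> 'k mpoly) (sorted_list_of_set T)"
  have "set xs \<subseteq> prime_of n F"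
    using T ideal_gen_superset[of "var ` F" n] by (auto simp: xs_def prime_of_def)
  moreover have "length xs = h" using T by (simp add: xs_def)
  moreover have "monomial (sqmon T) = prod_list xs"
    using T by (simp add: xs_def prod_var[symmetric] prod.distinct_set_conv_list[symmetric])
  ultimately have "(monomial (sqmon T) :: 'k mpoly) \<in> ?S"
    by (intro CollectI exI[of _ xs] conjI)
  then have T_in: "(monomial (sqmon T) :: 'k mpoly) \<in> ideal_gen n ?S" by (rule subsetD[OF ideal_gen_superset])
  have "x \<in> polyring n" if "x \<in> ?S" for x
  proof -
    obtain ys where "x = prod_list ys" "set ys \<subseteq> prime_of n F" using \<open>x \<in> ?S\<close> by blast
    then show ?thesis using prod_list_mon_ideal[OF F, of ys] by (simp add: mon_ideal_def)
  qed
  then have I: "is_ideal n (ideal_gen n ?S)" by (intro is_ideal_ideal_gen subsetI)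
  have d: "sqmon T + (a - sqmon T) = a"
    by (rule monom_dvd_diff) (use T sqmon_dvd_iff in auto)
  then have "keys (a - sqmon T) \<subseteq> {1..n}" using * keys_monom_add[of "sqmon T" "a - sqmon T"] by simp
  then have "(monomial (a - sqmon T) :: 'k mpoly) \<in> polyring n" by (simp add: monomial_polyring)
  then have "monomial (a - sqmon T) * monomial (sqmon T) \<in> ideal_gen n ?S"
    using I T_in unfolding is_ideal_def by blast
  then show "(monomial a :: 'k mpoly) \<in> ideal_pow n (prime_of n F) h"
    using d by (simp add: ideal_pow_def monomial_mult add.commute)
qed

section \<open>Minimal generators of the squarefree part of symbolic powers\<close>

context matroid
begin

lemma monomial_symb_pow:
  assumes "squarefree_monom a"
  shows "(monomial a :: 'k::field mpoly) \<in> symb_pow n (cover_ideal n \<B>) h \<longleftrightarrow>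
    keys a \<subseteq> {1..n} \<and> hits \<B> h (keys a)"
  unfolding symb_pow_def minimal_primes_eq hits_def
  using squarefree_monomial_ideal_pow[OF bases_sub assms, where 'k = 'k] by (auto simp: monomial_polyring)

text \<open>The monomials in the ideal are the multiples of those in \<open>N\<close>, and
  divisibility between squarefree monomials is inclusion of supports.\<close>

lemma mingens_SF:
  "mingens n (SF n h (cover_ideal n \<B>) :: 'k::field mpoly set) =
    {a. squarefree_monom a \<and> keys a \<in> minhits {1..n} \<B> h}"
proof -
  define N where "N = {a. squarefree_monom a \<and> keys a \<subseteq> {1..n} \<and> hits \<B> h (keys a)}"
  have "{monomial a | a. squarefree_monom a \<and> (monomial a :: 'k mpoly) \<in> symb_pow n (cover_ideal n \<B>) h}
      = (monomial ` N :: 'k mpoly set)"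
    using monomial_symb_pow[where 'k = 'k] by (auto simp: N_def)
  then have "(SF n h (cover_ideal n \<B>) :: 'k mpoly set) = ideal_gen n (monomial ` N)"
    by (simp only: SF_def)
  also have "\<dots> = mon_ideal n (\<lambda>m. \<exists>a\<in>N. monom_dvd a m)"
    by (rule ideal_gen_monomials) (simp add: N_def)
  finally have "(SF n h (cover_ideal n \<B>) :: 'k mpoly set) = mon_ideal n (\<lambda>m. \<exists>a\<in>N. monom_dvd a m)" .
  then have SF: "(monomial a :: 'k mpoly) \<in> SF n h (cover_ideal n \<B>) \<longleftrightarrow>
      keys a \<subseteq> {1..n} \<and> (\<exists>m\<in>N. monom_dvd m a)" for a
    by (simp add: monomial_mon_ideal)
  have dvd_refl: "monom_dvd a a" for a by (simp add: monom_dvd_def)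
  have antisym: "a = b" if "monom_dvd a b" "monom_dvd b a" for a b
    using that by (intro poly_mapping_eqI) (simp add: monom_dvd_def antisym)
  show ?thesis
  proof (intro set_eqI iffI)
    fix a assume "a \<in> mingens n (SF n h (cover_ideal n \<B>) :: 'k mpoly set)"
    then have a: "keys a \<subseteq> {1..n}" "\<exists>m\<in>N. monom_dvd m a"
      and m: "\<And>b. keys b \<subseteq> {1..n} \<Longrightarrow> \<exists>m\<in>N. monom_dvd m b \<Longrightarrow> monom_dvd b a \<Longrightarrow> b = a"
      unfolding mingens_def SF by auto
    have aN: "a \<in> N" using a m dvd_refl N_def by blast
    have "T = keys a" if T: "T \<subseteq> keys a" "hits \<B> h T" for T
    proof -
      have finT: "finite T" using finite_subset[OF T(1)] by simp
      then have "sqmon T \<in> N" using T a by (auto simp: N_def squarefree_sqmon keys_sqmon)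
      then have "sqmon T = a" using m[of "sqmon T"] T finT a dvd_refl by (auto simp: sqmon_dvd_iff keys_sqmon)
      then show ?thesis using keys_sqmon[OF finT] by simp
    qed
    then show "a \<in> {a. squarefree_monom a \<and> keys a \<in> minhits {1..n} \<B> h}"
      using aN by (auto simp: minhits_def N_def)
  next
    fix a assume "a \<in> {a. squarefree_monom a \<and> keys a \<in> minhits {1..n} \<B> h}"
    then have a: "squarefree_monom a" "keys a \<subseteq> {1..n}" "hits \<B> h (keys a)"
      and m: "\<And>T. T \<subseteq> keys a \<Longrightarrow> hits \<B> h T \<Longrightarrow> T = keys a" by (auto simp: minhits_def)
    have "b = a" if "m \<in> N" "monom_dvd m b" "monom_dvd b a" for b m
    proof -
      have "keys m \<subseteq> keys a" using that keys_monom_dvd by blast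
      then have "keys m = keys a" using m that by (auto simp: N_def)
      then have "m = a" using squarefree_eq_iff a that by (auto simp: N_def)
      then show ?thesis using antisym that by blast
    qed
    moreover have "a \<in> N" using a by (simp add: N_def)
    ultimately show "a \<in> mingens n (SF n h (cover_ideal n \<B>) :: 'k mpoly set)"
      unfolding mingens_def SF using dvd_refl a by blast
  qed
qed

end

subsection \<open>Strands of a multigraded resolution\<close>

lemma lookup_single_times_zero:
  fixes w :: "'k::field mpoly"
  assumes "\<not> monom_dvd m t"
  shows "lk (single m k * w) t = 0"
proof -
  have "t \<notin> keys (single m k * w)"
    using assms keys_mult[of "single m k" w] by (auto simp: monom_dvd_iff split: if_splits)
  then show ?thesis by (simp add: in_keys_iff)
qed

lemma monom_dvd_trans: "monom_dvd a b \<Longrightarrow> monom_dvd b c \<Longrightarrow> monom_dvd a c"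
  unfolding monom_dvd_def by (meson le_trans)

lemma monom_diff_add:
  assumes "monom_dvd a b" "monom_dvd b c"
  shows "(b - a) + (c - b) = c - a"
proof (rule poly_mapping_eqI)
  fix i
  have "lk a i \<le> lk b i" "lk b i \<le> lk c i" using assms by (auto simp: monom_dvd_def)
  then show "lk (b - a + (c - b)) i = lk (c - a) i" by (simp add: lookup_add lookup_minus)
qed

lemma keys_monom_diff: "monom_dvd a b \<Longrightarrow> keys (b - a) \<subseteq> keys b"
  using monom_dvd_diff[of a b] keys_monom_add[of a "b - a"] by auto

lemma single_sum: "single k (sum f A) = (\<Sum>x\<in>A. single k (f x))"
  by (induction A rule: infinite_finite_induct) (simp_all add: single_add)

lemma lookup_le_iff: "lk a \<le> lk b \<longleftrightarrow> monom_dvd a b"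
  by (simp add: le_fun_def monom_dvd_def)

locale graded_resolution = matroid n \<B> for n \<B> +
  fixes r :: "nat \<Rightarrow> nat" and dg :: "nat \<Rightarrow> nat \<Rightarrow> monom"
    and D :: "nat \<Rightarrow> nat \<Rightarrow> nat \<Rightarrow> ('k::field) mpoly" and E :: "nat \<Rightarrow> 'k mpoly"
  assumes res: "min_mg_free_res n (cover_ideal n \<B>) r dg D E"
begin

text \<open>The entry of the differential with all variables set to 1. Subtraction of exponents
  truncates, so the guard keeps only true quotients of degrees.\<close>

definition \<delta> :: "nat \<Rightarrow> nat \<Rightarrow> nat \<Rightarrow> 'k" where
  "\<delta> p i j = (if monom_dvd (dg p i) (dg (Suc p) j)
     then lk (D (Suc p) i j) (dg (Suc p) j - dg p i) else 0)"

definition \<epsilon> :: "nat \<Rightarrow> 'k" where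
  "\<epsilon> i = lk (E i) (dg 0 i)"

text \<open>The degree-\<open>b\<close> part of \<open>F\<^sub>p\<close> with its monomials
  stripped: \<open>c j\<close> is the coefficient of the basis element \<open>j\<close> times the
  monomial \<open>b - dg p j\<close>.\<close>

definition strand :: "nat \<Rightarrow> monom \<Rightarrow> (nat \<Rightarrow> 'k) set" where
  "strand p b = {c. \<forall>j. c j \<noteq> 0 \<longrightarrow> j < r p \<and> monom_dvd (dg p j) b}"

definition bd :: "nat \<Rightarrow> (nat \<Rightarrow> 'k) \<Rightarrow> nat \<Rightarrow> 'k" where
  "bd p c i = (if i < r p then \<Sum>j<r (Suc p). \<delta> p i j * c j else 0)"

text \<open>\<open>hom b\<close> embeds the strand of degree \<open>b\<close> into the free module; \<open>part b\<close> takes the component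
  of degree \<open>b\<close>.\<close>

definition hom :: "monom \<Rightarrow> nat \<Rightarrow> (nat \<Rightarrow> 'k) \<Rightarrow> nat \<Rightarrow> 'k mpoly" where
  "hom b p c j = (if j < r p \<and> monom_dvd (dg p j) b then single (b - dg p j) (c j) else 0)"

definition part :: "monom \<Rightarrow> nat \<Rightarrow> (nat \<Rightarrow> 'k mpoly) \<Rightarrow> nat \<Rightarrow> 'k" where
  "part b p w j = (if j < r p \<and> monom_dvd (dg p j) b then lk (w j) (b - dg p j) else 0)"

abbreviation mat :: "nat \<Rightarrow> (nat \<Rightarrow> 'k mpoly) \<Rightarrow> nat \<Rightarrow> 'k mpoly" where
  "mat p \<equiv> apply_mat (r p) (r (Suc p)) (D (Suc p))"

section \<open>The defining properties of the resolution, one by one\<close>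

lemma dg_keys: "j < r p \<Longrightarrow> keys (dg p j) \<subseteq> {1..n}"
proof -
  have "\<forall>h j. j < r h \<longrightarrow> keys (dg h j) \<subseteq> {1..n}"
    using res unfolding min_mg_free_res_def by (elim conjE)
  then show "j < r p \<Longrightarrow> keys (dg p j) \<subseteq> {1..n}" by blast
qed

lemma D_degree: "i < r p \<Longrightarrow> j < r (Suc p) \<Longrightarrow> m \<in> keys (D (Suc p) i j) \<Longrightarrow> m + dg p i = dg (Suc p) j"
proof -
  have "\<forall>h\<ge>1. \<forall>i<r (h-1). \<forall>j<r h. D h i j \<in> polyring n \<and>
        (\<forall>m\<in>keys (D h i j). m + dg (h-1) i = dg h j)"
    using res unfolding min_mg_free_res_def by (elim conjE)
  from this[rule_format, of "Suc p"]
  show "i < r p \<Longrightarrow> j < r (Suc p) \<Longrightarrow> m \<in> keys (D (Suc p) i j) \<Longrightarrow> m + dg p i = dg (Suc p) j"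
    by simp
qed

lemma D_minimal: "i < r p \<Longrightarrow> j < r (Suc p) \<Longrightarrow> D (Suc p) i j \<in> prime_of n {1..n}"
proof -
  have "\<forall>h\<ge>1. \<forall>i<r (h-1). \<forall>j<r h. D h i j \<in> ideal_gen n (var ` {1..n})"
    using res unfolding min_mg_free_res_def by (elim conjE)
  from this[rule_format, of "Suc p"]
  show "i < r p \<Longrightarrow> j < r (Suc p) \<Longrightarrow> D (Suc p) i j \<in> prime_of n {1..n}"
    by (simp add: prime_of_def)
qed

lemma exact_augmentation: "f \<in> polyring n \<Longrightarrow> \<exists>v\<in>freemod n (r 0). f - (\<Sum>i<r 0. v i * E i) \<in> cover_ideal n \<B>"
proof -
  have "\<forall>f\<in>polyring n. \<exists>v\<in>freemod n (r 0). f - (\<Sum>i<r 0. v i * E i) \<in> cover_ideal n \<B>"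
    using res unfolding min_mg_free_res_def by (elim conjE)
  then show "f \<in> polyring n \<Longrightarrow> \<exists>v\<in>freemod n (r 0). f - (\<Sum>i<r 0. v i * E i) \<in> cover_ideal n \<B>"
    by blast
qed

lemma exact_0: "v \<in> freemod n (r 0) \<Longrightarrow>
    (\<Sum>i<r 0. v i * E i) \<in> cover_ideal n \<B> \<longleftrightarrow> (\<exists>w\<in>freemod n (r (Suc 0)). v = mat 0 w)"
proof -
  have "\<forall>v\<in>freemod n (r 0). (\<Sum>i<r 0. v i * E i) \<in> cover_ideal n \<B> \<longleftrightarrow>
        (\<exists>w\<in>freemod n (r 1). v = apply_mat (r 0) (r 1) (D 1) w)"
    using res unfolding min_mg_free_res_def by (elim conjE)
  then show "v \<in> freemod n (r 0) \<Longrightarrow>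
    (\<Sum>i<r 0. v i * E i) \<in> cover_ideal n \<B> \<longleftrightarrow> (\<exists>w\<in>freemod n (r (Suc 0)). v = mat 0 w)"
    by simp
qed

lemma exact_Suc: "v \<in> freemod n (r (Suc p)) \<Longrightarrow>
    mat p v = (\<lambda>_. 0) \<longleftrightarrow> (\<exists>w\<in>freemod n (r (Suc (Suc p))). v = mat (Suc p) w)"
proof -
  have "\<forall>h\<ge>1. \<forall>v\<in>freemod n (r h). apply_mat (r (h-1)) (r h) (D h) v = (\<lambda>_. 0) \<longleftrightarrow>
        (\<exists>w\<in>freemod n (r (h+1)). v = apply_mat (r h) (r (h+1)) (D (h+1)) w)"
    using res unfolding min_mg_free_res_def by (elim conjE)
  from this[rule_format, of "Suc p" v]
  show "v \<in> freemod n (r (Suc p)) \<Longrightarrow>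
    mat p v = (\<lambda>_. 0) \<longleftrightarrow> (\<exists>w\<in>freemod n (r (Suc (Suc p))). v = mat (Suc p) w)"
    by simp
qed

lemma E_eq: "i < r 0 \<Longrightarrow> E i = single (dg 0 i) (\<epsilon> i)"
proof -
  assume i: "i < r 0"
  have "\<forall>i<r 0. E i \<in> polyring n \<and> homog (E i) (dg 0 i)"
    using res unfolding min_mg_free_res_def by (elim conjE)
  then have "homog (E i) (dg 0 i)" using i by blast
  then show ?thesis
    by (intro poly_mapping_eqI) (auto simp: \<epsilon>_def homog_def lookup_single when_def in_keys_iff)
qed

text \<open>Multihomogeneity admits only one monomial, the quotient of the two degrees.\<close>

lemma D_eq:
  assumes "i < r p" "j < r (Suc p)"
  shows "D (Suc p) i j = single (dg (Suc p) j - dg p i) (\<delta> p i j)"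
proof (rule poly_mapping_eqI)
  fix m
  show "lk (D (Suc p) i j) m = lk (single (dg (Suc p) j - dg p i) (\<delta> p i j)) m"
  proof (cases "m \<in> keys (D (Suc p) i j)")
    case True
    then have m: "dg (Suc p) j = dg p i + m" using D_degree[OF assms] by (simp add: add.commute)
    then have "monom_dvd (dg p i) (dg (Suc p) j)" unfolding monom_dvd_iff by blast
    then show ?thesis by (simp add: m \<delta>_def)
  next
    case False
    then show ?thesis by (auto simp: \<delta>_def lookup_single when_def in_keys_iff)
  qed
qed

text \<open>Equal degrees would make the entry a nonzero constant, which the maximal ideal does not
  contain.\<close>

lemma \<delta>_strict:
  assumes "i < r p" "j < r (Suc p)" "\<delta> p i j \<noteq> 0"
  shows "monom_dvd (dg p i) (dg (Suc p) j)" "dg p i \<noteq> dg (Suc p) j"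
proof -
  show "monom_dvd (dg p i) (dg (Suc p) j)" using assms(3) by (simp add: \<delta>_def split: if_splits)
  have "D (Suc p) i j \<in> mon_ideal n (\<lambda>m. keys m \<inter> {1..n} \<noteq> {})"
    using D_minimal[OF assms(1,2)] by (simp add: prime_of_eq)
  then show "dg p i \<noteq> dg (Suc p) j"
    using mon_ideal_D[of "D (Suc p) i j" n _ 0] assms(3) by (fastforce simp: D_eq[OF assms(1,2)])
qed

section \<open>Comparing a strand with the free modules\<close>

lemma hom_freemod: "keys b \<subseteq> {1..n} \<Longrightarrow> hom b p c \<in> freemod n (r p)"
  using keys_monom_diff by (fastforce simp: freemod_def hom_def polyring_def)

lemma part_strand: "part b p w \<in> strand p b"
  by (auto simp: part_def strand_def split: if_splits)

lemma part_hom: "c \<in> strand p b \<Longrightarrow> part b p (hom b p c) = c"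
  by (auto simp: part_def hom_def strand_def fun_eq_iff)

lemma bd_strand: "c \<in> strand (Suc p) b \<Longrightarrow> bd p c \<in> strand p b"
proof -
  assume c: "c \<in> strand (Suc p) b"
  have "i < r p \<and> monom_dvd (dg p i) b" if "bd p c i \<noteq> 0" for i
  proof -
    have i: "i < r p" and "(\<Sum>j<r (Suc p). \<delta> p i j * c j) \<noteq> 0"
      using that by (auto simp: bd_def split: if_splits)
    then obtain j where j: "j < r (Suc p)" "\<delta> p i j * c j \<noteq> 0"
      by (meson lessThan_iff sum.neutral)
    then have "monom_dvd (dg p i) (dg (Suc p) j)" "monom_dvd (dg (Suc p) j) b"
      using \<delta>_strict[OF i j(1)] c by (auto simp: strand_def)
    then show ?thesis using i monom_dvd_trans by blast
  qed
  then show "bd p c \<in> strand p b" by (simp add: strand_def)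
qed

text \<open>Quotients of exponents compose along divisibility, so the differential acts on an
  embedded strand through the scalars \<delta>.\<close>

lemma mat_hom:
  assumes c: "c \<in> strand (Suc p) b"
  shows "mat p (hom b (Suc p) c) = hom b p (bd p c)"
proof
  fix i
  show "mat p (hom b (Suc p) c) i = hom b p (bd p c) i"
  proof (cases "i < r p")
    case True
    have "D (Suc p) i j * hom b (Suc p) c j = single (b - dg p i) (\<delta> p i j * c j)"
      if j: "j < r (Suc p)" for j
    proof (cases "\<delta> p i j * c j = 0")
      case z: True
      then show ?thesis by (auto simp: D_eq[OF True j] hom_def mult_single)
    next
      case False
      then have "monom_dvd (dg p i) (dg (Suc p) j)" "monom_dvd (dg (Suc p) j) b"
        using \<delta>_strict[OF True j] c by (auto simp: strand_def)
      then show ?thesis using j by (simp add: D_eq[OF True j] hom_def mult_single monom_diff_add)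
    qed
    then have "mat p (hom b (Suc p) c) i = (\<Sum>j<r (Suc p). single (b - dg p i) (\<delta> p i j * c j))"
      using True by (simp add: apply_mat_def)
    also have "\<dots> = single (b - dg p i) (bd p c i)"
      using True by (simp add: bd_def single_sum)
    also have "\<dots> = hom b p (bd p c) i"
    proof (cases "bd p c i = 0")
      case False
      then have "monom_dvd (dg p i) b" using bd_strand[OF c] by (simp add: strand_def)
      then show ?thesis using True by (simp add: hom_def)
    qed (simp add: hom_def)
    finally show ?thesis .
  qed (simp add: apply_mat_def hom_def)
qed

lemma part_mat: "part b p (mat p w) = bd p (part b (Suc p) w)"
proof
  fix i
  show "part b p (mat p w) i = bd p (part b (Suc p) w) i"
  proof (cases "i < r p \<and> monom_dvd (dg p i) b")
    case True
    then have i: "i < r p" and ib: "monom_dvd (dg p i) b" by auto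
    have "lk (D (Suc p) i j * w j) (b - dg p i) = \<delta> p i j * part b (Suc p) w j"
      if j: "j < r (Suc p)" for j
    proof (cases "\<delta> p i j = 0")
      case z: False
      have ij: "monom_dvd (dg p i) (dg (Suc p) j)" using \<delta>_strict[OF i j z] by simp
      show ?thesis
      proof (cases "monom_dvd (dg (Suc p) j) b")
        case True
        then show ?thesis
          using lookup_single_times[of "dg (Suc p) j - dg p i" "\<delta> p i j" "w j" "b - dg (Suc p) j"] j
          by (simp add: D_eq[OF i j] part_def monom_diff_add[OF ij True])
      next
        case False
        \<comment> \<open>If \<open>dg (Suc p) j\<close> does not divide \<open>b\<close>, the
          product has no term in the required degree, in agreement with the value 0 of
          \<open>part\<close>.\<close>
        have "\<not> monom_dvd (dg (Suc p) j - dg p i) (b - dg p i)"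
        proof
          assume *: "monom_dvd (dg (Suc p) j - dg p i) (b - dg p i)"
          have "lk (dg (Suc p) j) l \<le> lk b l" for l
          proof -
            have "lk (dg (Suc p) j) l - lk (dg p i) l \<le> lk b l - lk (dg p i) l"
              using * by (simp add: monom_dvd_def lookup_minus)
            moreover have "lk (dg p i) l \<le> lk b l" using ib by (simp add: monom_dvd_def)
            ultimately show ?thesis by linarith
          qed
          then show False using False by (simp add: monom_dvd_def)
        qed
        then show ?thesis using False by (simp add: D_eq[OF i j] part_def lookup_single_times_zero)
      qed
    qed (simp add: D_eq[OF i j])
    then show ?thesis using True by (simp add: part_def apply_mat_def bd_def lookup_sum)
  next
    case False
    then show ?thesis using bd_strand[OF part_strand, of p b w] by (auto simp: part_def strand_def)
  qed
qed

text \<open>\<open>hom b\<close> and \<open>part b\<close> commute with the differentials, and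
  \<open>part b\<close> undoes \<open>hom b\<close> on the strand; so exactness passes from the
  modules to the strand.\<close>

lemma strand_exact:
  assumes b: "keys b \<subseteq> {1..n}" and z: "z \<in> strand (Suc p) b"
  shows "bd p z = (\<lambda>_. 0) \<longleftrightarrow> (\<exists>u\<in>strand (Suc (Suc p)) b. bd (Suc p) u = z)"
proof
  assume "bd p z = (\<lambda>_. 0)"
  then have "mat p (hom b (Suc p) z) = (\<lambda>_. 0)" unfolding mat_hom[OF z] by (simp add: hom_def fun_eq_iff)
  then obtain w where "hom b (Suc p) z = mat (Suc p) w" using exact_Suc[OF hom_freemod[OF b]] by blast
  then have "z = bd (Suc p) (part b (Suc (Suc p)) w)"
    using part_hom[OF z] by (simp add: part_mat[symmetric])
  then show "\<exists>u\<in>strand (Suc (Suc p)) b. bd (Suc p) u = z" using part_strand by blast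
next
  assume "\<exists>u\<in>strand (Suc (Suc p)) b. bd (Suc p) u = z"
  then obtain u where u: "u \<in> strand (Suc (Suc p)) b" "bd (Suc p) u = z" by blast
  have "hom b (Suc p) z = mat (Suc p) (hom b (Suc (Suc p)) u)" using mat_hom[OF u(1)] u(2) by simp
  then have "mat p (hom b (Suc p) z) = (\<lambda>_. 0)" using exact_Suc[OF hom_freemod[OF b]] hom_freemod[OF b] by blast
  then have "hom b p (bd p z) = (\<lambda>_. 0)" by (simp add: mat_hom[OF z])
  moreover have "part b p (\<lambda>_. 0) = (\<lambda>_. 0)" by (simp add: part_def fun_eq_iff)
  ultimately show "bd p z = (\<lambda>_. 0)" using part_hom[OF bd_strand[OF z]] by simp
qed

text \<open>The augmentation sends \<open>hom b 0 z\<close> to a scalar times the monomial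
  \<open>b\<close>. This lies in the ideal iff the scalar vanishes or \<open>b\<close> does.\<close>

lemma strand_exact0:
  assumes b: "keys b \<subseteq> {1..n}" and z: "z \<in> strand 0 b"
  shows "(\<exists>u\<in>strand (Suc 0) b. bd 0 u = z) \<longleftrightarrow> hits \<B> (Suc 0) (keys b) \<or> (\<Sum>i<r 0. \<epsilon> i * z i) = 0"
proof -
  have "(\<Sum>i<r 0. hom b 0 z i * E i) = (\<Sum>i<r 0. single b (\<epsilon> i * z i))"
  proof (rule sum.cong)
    fix i assume "i \<in> {..<r 0}"
    then have i: "i < r 0" by simp
    show "hom b 0 z i * E i = single b (\<epsilon> i * z i)"
    proof (cases "z i = 0")
      case False
      then have "monom_dvd (dg 0 i) b" using z by (auto simp: strand_def)
      then show ?thesis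
        using i by (simp add: hom_def E_eq mult_single mult.commute add.commute[of "b - dg 0 i"] monom_dvd_diff)
    qed (simp add: hom_def)
  qed simp
  also have "\<dots> = single b (\<Sum>i<r 0. \<epsilon> i * z i)"
    by (simp add: single_sum)
  finally have "(\<Sum>i<r 0. hom b 0 z i * E i) \<in> cover_ideal n \<B> \<longleftrightarrow>
      hits \<B> (Suc 0) (keys b) \<or> (\<Sum>i<r 0. \<epsilon> i * z i) = 0"
    using b by (auto simp: cover_ideal_eq mon_ideal_def polyring_def)
  moreover have "(\<exists>u\<in>strand (Suc 0) b. bd 0 u = z) \<longleftrightarrow> (\<exists>w\<in>freemod n (r (Suc 0)). hom b 0 z = mat 0 w)"
  proof
    assume "\<exists>u\<in>strand (Suc 0) b. bd 0 u = z"
    then obtain u where u: "u \<in> strand (Suc 0) b" "bd 0 u = z" by blast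
    show "\<exists>w\<in>freemod n (r (Suc 0)). hom b 0 z = mat 0 w"
      by (rule bexI[OF _ hom_freemod[OF b, of _ u]]) (simp add: mat_hom[OF u(1)] u(2))
  next
    assume "\<exists>w\<in>freemod n (r (Suc 0)). hom b 0 z = mat 0 w"
    then obtain w where w: "hom b 0 z = mat 0 w" by blast
    have "bd 0 (part b (Suc 0) w) = z" unfolding part_mat[symmetric] w[symmetric] by (rule part_hom[OF z])
    then show "\<exists>u\<in>strand (Suc 0) b. bd 0 u = z" using part_strand by blast
  qed
  ultimately show ?thesis using exact_0[OF hom_freemod[OF b]] by simp
qed

lemma not_hits_empty: "\<not> hits \<B> (Suc 0) {}"
  using nonempty by (auto simp: hits_def)

text \<open>The cover ideal has no polynomial with a constant term, so hitting 1 modulo it takes a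
  generator whose image \<open>E i\<close> is a nonzero constant.\<close>

lemma augmentation_unit: "\<exists>i<r 0. dg 0 i = 0 \<and> \<epsilon> i \<noteq> 0"
proof -
  have "1 \<in> (polyring n :: 'k mpoly set)" by (simp add: polyring_def)
  then obtain v where "1 - (\<Sum>i<r 0. v i * E i) \<in> cover_ideal n \<B>" using exact_augmentation by blast
  then have "lk (1 - (\<Sum>i<r 0. v i * E i)) 0 = 0"
    using mon_ideal_D[of _ n _ 0] not_hits_empty unfolding cover_ideal_eq in_keys_iff by force
  then have "(\<Sum>i<r 0. lk (E i * v i) 0) \<noteq> 0"
    by (simp add: lookup_minus lookup_sum lookup_one mult.commute)
  then obtain i where i: "i < r 0" "lk (E i * v i) 0 \<noteq> 0" by (meson lessThan_iff sum.neutral)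
  then have "monom_dvd (dg 0 i) 0" using lookup_single_times_zero E_eq by metis
  then have "dg 0 i = 0" by (intro poly_mapping_eqI) (simp add: monom_dvd_def)
  moreover have "\<epsilon> i \<noteq> 0" using i by (auto simp: E_eq)
  ultimately show ?thesis using i by blast
qed

text \<open>Membership in the cover ideal depends on the support only, so
  \<open>degrees_fixed\<close> applies to truncation of all exponents at 1. Degrees enter as
  exponent functions, whose pointwise order is divisibility.\<close>

lemma squarefree_dg:
  assumes j: "j < r p"
  shows "squarefree_monom (dg p j)"
proof -
  let ?\<Omega> = "{lk m | m :: monom. keys m \<subseteq> {1..n}}" and ?J = "{lk m | m :: monom. hits \<B> (Suc 0) (keys m)}"
  let ?\<phi> = "\<lambda>f::nat \<Rightarrow> nat. \<lambda>i. min (f i) 1"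
  have strand: "{c. \<forall>j. c j \<noteq> 0 \<longrightarrow> j < r p \<and> lk (dg p j) \<in> {..lk b}} = strand p b" for p b
    by (simp add: strand_def lookup_le_iff)
  have bd: "(\<lambda>i. if i < r p then \<Sum>j<r (Suc p). \<delta> p i j * c j else 0) = bd p c" for p c
    by (simp add: bd_def fun_eq_iff)
  have less: "lk a < lk b" if "monom_dvd a b" "a \<noteq> b" for a b
    using that by (simp add: less_le lookup_le_iff)
  interpret F: filtered_resolution r "\<lambda>p j. lk (dg p j)" \<delta> \<epsilon> ?\<Omega> ?J
      "\<lambda>p X. {c. \<forall>j. c j \<noteq> 0 \<longrightarrow> j < r p \<and> lk (dg p j) \<in> X}"
      "\<lambda>p c i. if i < r p then \<Sum>j<r (Suc p). \<delta> p i j * c j else 0"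
  proof (unfold_locales, goal_cases)
    case (1 j p)
    then show ?case using dg_keys by blast
  next
    case (2 i p j)
    then show ?case using less \<delta>_strict by blast
  next
    case (3 b z p)
    then obtain m where m: "b = lk m" "keys m \<subseteq> {1..n}" by blast
    have "z \<in> strand (Suc p) m" using 3(2) unfolding m(1) strand .
    then show ?case unfolding m(1) strand bd by (rule strand_exact[OF m(2)])
  next
    case (4 b z)
    then obtain m where m: "b = lk m" "keys m \<subseteq> {1..n}" by blast
    have "(lk m \<in> ?J) = hits \<B> (Suc 0) (keys m)" by auto
    moreover have "z \<in> strand 0 m" using 4(2) unfolding m(1) strand .
    ultimately show ?case using strand_exact0[OF m(2)] unfolding m(1) strand bd One_nat_def by simp
  next
    case 5
    obtain i where "i < r 0" "dg 0 i = 0" "\<epsilon> i \<noteq> 0" using augmentation_unit by blast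
    then show ?case by (intro exI[of _ i]) (simp add: fun_eq_iff bot_nat_def)
  qed
  have \<phi>: "?\<phi> (lk m) = lk (sqmon (keys m))" for m
    by (auto simp: lookup_sqmon fun_eq_iff in_keys_iff)
  have "?\<phi> (lk (dg p j)) = lk (dg p j)"
  proof (rule F.degrees_fixed[of ?\<Omega>])
    fix b c assume "b \<in> ?\<Omega>" "c \<in> ?\<Omega>" "c \<le> b"
    then show "c \<in> ?\<Omega>" by blast
  next
    fix b c :: "nat \<Rightarrow> nat" assume "c \<le> b"
    then show "?\<phi> c \<le> ?\<phi> b" unfolding le_fun_def by (meson min.mono order_refl)
  next
    fix b assume "b \<in> ?\<Omega>"
    then obtain m where m: "b = lk m" "keys m \<subseteq> {1..n}" by blast
    show "?\<phi> b \<in> ?\<Omega>" unfolding m(1) \<phi> using m(2) keys_sqmon by auto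
    show "?\<phi> b \<le> b" by (simp add: le_fun_def)
    show "?\<phi> b \<in> ?J" if "b \<in> ?J"
    proof -
      from that obtain m where m: "b = lk m" "hits \<B> (Suc 0) (keys m)" by blast
      show ?thesis unfolding m(1) \<phi> using m(2) keys_sqmon by auto
    qed
  qed (use j dg_keys in auto)
  then show ?thesis unfolding squarefree_monom_def by (metis min.cobounded2)
qed

text \<open>As the degrees are squarefree, they may be replaced by their supports; the chains on
  subsets of \<open>S\<close> then form the strand of degree \<open>sqmon S\<close>.\<close>

lemma dg_eq_minhits:
  assumes h: "h \<ge> 1"
  shows "(\<lambda>j. keys (dg h j)) ` {0..<r h} = minhits {1..n} \<B> h"
proof -
  have fin: "finite S" if "S \<subseteq> {1..n}" for S using that finite_subset by blast
  have strand: "{c. \<forall>j. c j \<noteq> 0 \<longrightarrow> j < r p \<and> keys (dg p j) \<in> {..S}} = strand p (sqmon S)"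
    if S: "S \<subseteq> {1..n}" for p S
  proof -
    have "monom_dvd (dg p j) (sqmon S) \<longleftrightarrow> keys (dg p j) \<subseteq> S" if "j < r p" for j
      using sqmon_dvd_iff[of "keys (dg p j)" "sqmon S"] squarefree_eq_sqmon[OF squarefree_dg[OF that]]
        keys_sqmon[OF fin[OF S]] by simp
    then show ?thesis by (auto simp: strand_def)
  qed
  have bd: "(\<lambda>i. if i < r p then \<Sum>j<r (Suc p). \<delta> p i j * c j else 0) = bd p c" for p c
    by (simp add: bd_def fun_eq_iff)
  interpret F: matroidal_resolution r "\<lambda>p j. keys (dg p j)" \<delta> \<epsilon> "{1..n}" \<B>
      "\<lambda>p X. {c. \<forall>j. c j \<noteq> 0 \<longrightarrow> j < r p \<and> keys (dg p j) \<in> X}"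
      "\<lambda>p c i. if i < r p then \<Sum>j<r (Suc p). \<delta> p i j * c j else 0"
  proof (unfold_locales, goal_cases)
    case (1 j p)
    then show ?case using dg_keys by blast
  next
    case (2 i p j)
    \<comment> \<open>Distinct squarefree monomials have distinct supports, so strictness survives
      the passage to supports.\<close>
    have "keys (dg p i) \<subseteq> keys (dg (Suc p) j)" "keys (dg p i) \<noteq> keys (dg (Suc p) j)"
      using \<delta>_strict[OF 2] keys_monom_dvd squarefree_eq_iff squarefree_dg 2 by blast+
    then show ?case by auto
  next
    case (3 b z p)
    then have b: "b \<subseteq> {1..n}" by simp
    have "z \<in> strand (Suc p) (sqmon b)" using 3(2) unfolding strand[OF b] .
    then show ?case unfolding strand[OF b] bd
      by (rule strand_exact[rotated]) (simp only: keys_sqmon[OF fin[OF b]] b)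
  next
    case (4 b z)
    then have b: "b \<subseteq> {1..n}" by simp
    have "z \<in> strand 0 (sqmon b)" using 4(2) unfolding strand[OF b] .
    moreover have "keys (sqmon b) = b" by (rule keys_sqmon[OF fin[OF b]])
    ultimately show ?case
      unfolding strand[OF b] bd One_nat_def using strand_exact0[of "sqmon b" z] b by simp
  next
    case 5
    obtain i where "i < r 0" "dg 0 i = 0" "\<epsilon> i \<noteq> 0" using augmentation_unit by blast
    then show ?case by (intro exI[of _ i]) simp
  next
    case 6
    then show ?case by simp
  next
    case 7
    then show ?case by (rule nonempty)
  next
    case (8 S k c T)
    then show ?case using matroid_coloop[OF M fin] by blast
  qed
  show ?thesis using F.dg_image[OF h] .
qed

lemma mdeg_eq:
  assumes h: "h \<ge> 1"
  shows "mdeg r dg h = {a. squarefree_monom a \<and> keys a \<in> minhits {1..n} \<B> h}"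
proof (intro set_eqI iffI)
  fix a assume "a \<in> mdeg r dg h"
  then show "a \<in> {a. squarefree_monom a \<and> keys a \<in> minhits {1..n} \<B> h}"
    using dg_eq_minhits[OF h] squarefree_dg by (auto simp: mdeg_def)
next
  fix a assume a: "a \<in> {a. squarefree_monom a \<and> keys a \<in> minhits {1..n} \<B> h}"
  then obtain j where j: "j < r h" "keys a = keys (dg h j)" unfolding dg_eq_minhits[OF h, symmetric] by auto
  then have "a = dg h j" using a squarefree_eq_iff squarefree_dg by blast
  then show "a \<in> mdeg r dg h" using j by (auto simp: mdeg_def)
qed

end

theorem theorem5p3:
  fixes n :: nat and J :: "('k::field) mpoly set"
    and r :: "nat \<Rightarrow> nat" and dg :: "nat \<Rightarrow> nat \<Rightarrow> monom"
    and D :: "nat \<Rightarrow> nat \<Rightarrow> nat \<Rightarrow> 'k mpoly" and E :: "nat \<Rightarrow> 'k mpoly"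
  assumes "C_matroidal n J"
    and "min_mg_free_res n J r dg D E"
    and "h \<ge> 1"
  shows "mingens n (SF n h J) = mdeg r dg h"
proof -
  obtain \<B> where \<B>: "matroid_bases n \<B>" "J = cover_ideal n \<B>"
    using assms(1) by (auto simp: C_matroidal_def)
  interpret graded_resolution n \<B> r dg D E
    by unfold_locales (use \<B> assms(2) in auto)
  \<comment> \<open>Both sides consist of the squarefree monomials with support in
    \<open>minhits {1..n} \<B> h\<close>.\<close>
  show ?thesis unfolding \<B>(2) mingens_SF mdeg_eq[OF assms(3)] ..
qed

end
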